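(* Let $n\ge 1$. The Zariski closures $$\overline{\bigcup_{b_2,\dots,b_n\in F}\operatorname{Orb}(\nu_1(b_2,b_3,\dots,b_n))}\qquad\text{and}\qquad \overline{\bigcup_{c_2,\dots,c_n\in F}\operatorname{Orb}(\eta_1(c_2,c_3,\dots,c_n))}$$ are irreducible components of the varieties $Leib^{n,n}$ and $Leib^{n,n+1}$, respectively.
   Context: $F$ is a field of characteristic zero. A Leibniz superalgebra is a $\mathbb Z_2$-graded vector space $L=L_0\oplus L_1$ with a bilinear product with $[L_a,L_b]\subseteq L_{a+b}$ such that $[x,[y,z]]=[[x,y],z]-(-1)^{|y||z|}[[x,z],y]$ for all $x\in L$ and homogeneous $y,z$ of degrees $|y|,|z|$. $Leib^{n,m}$ is the set of all Leibniz superalgebra laws on a fixed graded space $V=V_0\oplus V_1$ with $\dim V_0=n$, $\dim V_1=m$, viewed through structure constants in fixed bases $x_1,\dots,x_n$ of $V_0$ and $y_1,\dots,y_m$ of $V_1$ as a Zariski closed subset of an affine space over $F$. The group $GL_n(F)\oplus GL_m(F)$ of invertible degree-preserving linear maps $f=f_0+f_1$ acts by $(f\cdot\mu)(x,y)=f_{\alpha+\beta}^{-1}(\mu(f_\alpha(x),f_\beta(y)))$ for $x\in V_\alpha$, $y\in V_\beta$; $\operatorname{Orb}(\mu)$ is the orbit of $\mu$ (all laws isomorphic to $\mu$). For $b_2,\dots,b_n\in F$, $\nu_1(b_2,\dots,b_n)\in Leib^{n,n}$ has the products (all omitted ones being zero): $[y_i,y_1]=x_i$ ($1\le i\le n$);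 $[x_i,y_1]=\frac12 y_{i+1}$ ($1\le i\le n-1$); $[x_n,y_1]=\sum_{k=2}^n b_ky_k$; $[y_i,x_1]=y_{i+1}$ ($1\le i\le n-1$); $[y_n,x_1]=2\sum_{k=2}^n b_ky_k$; $[x_i,x_1]=x_{i+1}$ ($1\le i\le n-1$); $[x_n,x_1]=2\sum_{k=2}^n b_kx_k$. For $c_2,\dots,c_n\in F$, $\eta_1(c_2,\dots,c_n)\in Leib^{n,n+1}$ has the products (all omitted ones being zero): $[x_i,x_1]=x_{i+1}$ ($1\le i\le n-1$); $[x_n,x_1]=\sum_{k=2}^n c_kx_k$; $[y_i,x_1]=y_{i+1}$ ($1\le i\le n$); $[y_{n+1},x_1]=\sum_{k=2}^n c_ky_{k+1}$; $[y_i,y_1]=x_i$ ($1\le i\le n$); $[y_{n+1},y_1]=\sum_{k=2}^n c_kx_k$; $[x_i,y_1]=\frac12 y_{i+1}$ ($1\le i\le n$). *)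

theory Defs
  imports
    "HOL-Analysis.Abstract_Topology"
    "HOL-Library.Poly_Mapping"
    "HOL-Library.Function_Algebras"
begin

section \<open>Zariski topology on an affine space\<close>

text \<open>
  A point of the affine space with coordinates indexed by \<open>I\<close> is a function vanishing off \<open>I\<close>.
  A polynomial is a finitely supported map from monomials (finitely supported exponent vectors)
  to coefficients.  For an arbitrary field the topology is that on the set of rational points.
\<close>

definition affine_space :: "'v set \<Rightarrow> ('v \<Rightarrow> 'a::zero) set" where
  "affine_space I = {x. \<forall>v. v \<notin> I \<longrightarrow> x v = 0}"

definition polynomials :: "'v set \<Rightarrow> (('v \<Rightarrow>\<^sub>0 nat) \<Rightarrow>\<^sub>0 'a::comm_ring_1) set" where
  "polynomials I = {p. \<forall>m \<in> Poly_Mapping.keys p. Poly_Mapping.keys m \<subseteq> I}"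

definition monomial_eval :: "('v \<Rightarrow>\<^sub>0 nat) \<Rightarrow> ('v \<Rightarrow> 'a::comm_ring_1) \<Rightarrow> 'a" where
  "monomial_eval m x = (\<Prod>v\<in>Poly_Mapping.keys m. x v ^ Poly_Mapping.lookup m v)"

definition poly_eval :: "(('v \<Rightarrow>\<^sub>0 nat) \<Rightarrow>\<^sub>0 'a::comm_ring_1) \<Rightarrow> ('v \<Rightarrow> 'a) \<Rightarrow> 'a" where
  "poly_eval p x =
     (\<Sum>m\<in>Poly_Mapping.keys p. Poly_Mapping.lookup p m * monomial_eval m x)"

definition zero_locus ::
    "'v set \<Rightarrow> (('v \<Rightarrow>\<^sub>0 nat) \<Rightarrow>\<^sub>0 'a::comm_ring_1) set \<Rightarrow> ('v \<Rightarrow> 'a) set" where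
  "zero_locus I P = {x \<in> affine_space I. \<forall>p\<in>P. poly_eval p x = 0}"

definition zariski :: "'v set \<Rightarrow> ('v \<Rightarrow> 'a::field) topology" where
  "zariski I = topology (\<lambda>U. \<exists>P \<subseteq> polynomials I. U = affine_space I - zero_locus I P)"

lemma poly_eval_zero: "poly_eval 0 x = 0"
  by (simp add: poly_eval_def)

lemma poly_eval_one: "poly_eval 1 x = 1"
  by (simp add: poly_eval_def monomial_eval_def)

lemma poly_eval_add: "poly_eval (p + q) x = poly_eval p x + poly_eval q x"
  unfolding poly_eval_def
  by (rule Poly_Mapping.setsum_keys_plus_distrib) (simp_all add: distrib_right)

lemma poly_eval_sum: "poly_eval (\<Sum>i\<in>A. f i) x = (\<Sum>i\<in>A. poly_eval (f i) x)"
  by (induction A rule: infinite_finite_induct) (simp_all add: poly_eval_zero poly_eval_add)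

lemma poly_eval_single: "poly_eval (Poly_Mapping.single m c) x = c * monomial_eval m x"
  by (simp add: poly_eval_def)

lemma sum_single_keys:
  "(\<Sum>m\<in>Poly_Mapping.keys p. Poly_Mapping.single m (Poly_Mapping.lookup p m)) = p"
  by (rule poly_mapping_eqI)
     (auto simp: lookup_sum lookup_single when_def in_keys_iff)

lemma monomial_eval_superset:
  assumes "finite K" "Poly_Mapping.keys m \<subseteq> K"
  shows "monomial_eval m x = (\<Prod>v\<in>K. x v ^ Poly_Mapping.lookup m v)"
  unfolding monomial_eval_def
  by (rule prod.mono_neutral_left) (use assms in \<open>auto simp: in_keys_iff\<close>)

lemma monomial_eval_add: "monomial_eval (m + k) x = monomial_eval m x * monomial_eval k x"
proof -
  let ?K = "Poly_Mapping.keys m \<union> Poly_Mapping.keys k"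
  have "monomial_eval l x = (\<Prod>v\<in>?K. x v ^ Poly_Mapping.lookup l v)"
    if "Poly_Mapping.keys l \<subseteq> ?K" for l
    using that by (intro monomial_eval_superset) auto
  then show ?thesis
    by (simp add: Poly_Mapping.keys_add lookup_add power_add prod.distrib)
qed

lemma poly_eval_mult: "poly_eval (p * q) x = poly_eval p x * poly_eval q x"
proof -
  have "p * q =
      (\<Sum>m\<in>Poly_Mapping.keys p. Poly_Mapping.single m (Poly_Mapping.lookup p m)) *
      (\<Sum>k\<in>Poly_Mapping.keys q. Poly_Mapping.single k (Poly_Mapping.lookup q k))"
    by (simp only: sum_single_keys)
  also have "poly_eval \<dots> x =
      (\<Sum>m\<in>Poly_Mapping.keys p. \<Sum>k\<in>Poly_Mapping.keys q.
        (Poly_Mapping.lookup p m * Poly_Mapping.lookup q k) * monomial_eval (m + k) x)"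
    by (simp only: sum_product mult_single poly_eval_sum poly_eval_single)
  also have "\<dots> = poly_eval p x * poly_eval q x"
    unfolding poly_eval_def sum_product monomial_eval_add by (simp only: mult_ac)
  finally show ?thesis .
qed

lemma polynomials_mult:
  assumes p: "p \<in> polynomials I" and q: "q \<in> polynomials I"
  shows "p * q \<in> polynomials I"
  unfolding polynomials_def
proof (intro CollectI ballI)
  fix m assume "m \<in> Poly_Mapping.keys (p * q)"
  then obtain a b where "m = a + b" "a \<in> Poly_Mapping.keys p" "b \<in> Poly_Mapping.keys q"
    using Poly_Mapping.keys_mult[of p q] by blast
  then show "Poly_Mapping.keys m \<subseteq> I"
    using p q Poly_Mapping.keys_add[of a b] unfolding polynomials_def by blast
qed

lemma istopology_zariski:
  "istopology (\<lambda>U. \<exists>P \<subseteq> polynomials I.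
     U = affine_space I - zero_locus I (P :: (('v \<Rightarrow>\<^sub>0 nat) \<Rightarrow>\<^sub>0 'a::field) set))"
  unfolding istopology_def
proof (intro conjI allI impI)
  fix S T :: "('v \<Rightarrow> 'a) set"
  assume "\<exists>P\<subseteq>polynomials I. S = affine_space I - zero_locus I P"
    and "\<exists>P\<subseteq>polynomials I. T = affine_space I - zero_locus I P"
  then obtain P Q where P: "P \<subseteq> polynomials I" "S = affine_space I - zero_locus I P"
    and Q: "Q \<subseteq> polynomials I" "T = affine_space I - zero_locus I Q" by blast
  let ?R = "{p * q |p q. p \<in> P \<and> q \<in> Q}"
  have "?R \<subseteq> polynomials I"
    using P Q by (auto intro: polynomials_mult)
  moreover have "S \<inter> T = affine_space I - zero_locus I ?R"
  proof (intro equalityI subsetI)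
    fix x assume "x \<in> S \<inter> T"
    then obtain p q where "x \<in> affine_space I" "p \<in> P" "q \<in> Q"
      "poly_eval p x \<noteq> 0" "poly_eval q x \<noteq> 0"
      unfolding P Q zero_locus_def by blast
    then have "x \<in> affine_space I" "p * q \<in> ?R" "poly_eval (p * q) x \<noteq> 0"
      by (auto simp: poly_eval_mult)
    then show "x \<in> affine_space I - zero_locus I ?R"
      unfolding zero_locus_def by blast
  next
    fix x assume "x \<in> affine_space I - zero_locus I ?R"
    then obtain p q where "x \<in> affine_space I" "p \<in> P" "q \<in> Q" "poly_eval (p * q) x \<noteq> 0"
      unfolding zero_locus_def by blast
    then show "x \<in> S \<inter> T"
      unfolding P Q zero_locus_def by (auto simp: poly_eval_mult)
  qed
  ultimately show "\<exists>P\<subseteq>polynomials I. S \<inter> T = affine_space I - zero_locus I P" by blast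
next
  fix \<K> :: "('v \<Rightarrow> 'a) set set"
  assume "\<forall>K\<in>\<K>. \<exists>P\<subseteq>polynomials I. K = affine_space I - zero_locus I P"
  then obtain P where P: "\<And>K. K \<in> \<K> \<Longrightarrow> P K \<subseteq> polynomials I"
    "\<And>K. K \<in> \<K> \<Longrightarrow> K = affine_space I - zero_locus I (P K)" by metis
  have "\<Union>(P ` \<K>) \<subseteq> polynomials I" using P(1) by blast
  moreover have "\<Union>\<K> = affine_space I - zero_locus I (\<Union>(P ` \<K>))"
  proof -
    have "\<Union>\<K> = (\<Union>K\<in>\<K>. affine_space I - zero_locus I (P K))"
      using P(2) by auto
    then show ?thesis unfolding zero_locus_def by auto
  qed
  ultimately show "\<exists>P\<subseteq>polynomials I. \<Union>\<K> = affine_space I - zero_locus I P" by blast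
qed

lemma openin_zariski:
  "openin (zariski I) U \<longleftrightarrow>
     (\<exists>P \<subseteq> polynomials I. U = affine_space I - zero_locus I P)"
  unfolding zariski_def using istopology_zariski by (subst topology_inverse') auto

lemma topspace_zariski: "topspace (zariski I :: ('v \<Rightarrow> 'a::field) topology) = affine_space I"
proof
  show "topspace (zariski I) \<subseteq> (affine_space I :: ('v \<Rightarrow> 'a) set)"
    unfolding topspace_def by (auto simp: openin_zariski)
  have "affine_space I = (affine_space I :: ('v \<Rightarrow> 'a) set) - zero_locus I {1}"
    by (simp add: zero_locus_def poly_eval_one)
  moreover have "{1} \<subseteq> (polynomials I :: (('v \<Rightarrow>\<^sub>0 nat) \<Rightarrow>\<^sub>0 'a) set)"
    by (auto simp: polynomials_def)
  ultimately have "openin (zariski I) (affine_space I :: ('v \<Rightarrow> 'a) set)"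
    unfolding openin_zariski by blast
  then show "(affine_space I :: ('v \<Rightarrow> 'a) set) \<subseteq> topspace (zariski I)"
    by (rule openin_subset)
qed

lemma closedin_zariski:
  "closedin (zariski I) C \<longleftrightarrow> (\<exists>P \<subseteq> polynomials I. C = zero_locus I P)"
proof -
  have sub: "zero_locus I P \<subseteq> affine_space I" for P :: "(('a \<Rightarrow>\<^sub>0 nat) \<Rightarrow>\<^sub>0 'b) set"
    by (auto simp: zero_locus_def)
  show ?thesis
    unfolding closedin_def topspace_zariski openin_zariski
  proof (intro iffI)
    assume "C \<subseteq> affine_space I \<and>
      (\<exists>P\<subseteq>polynomials I. affine_space I - C = affine_space I - zero_locus I P)"
    then show "\<exists>P\<subseteq>polynomials I. C = zero_locus I P"
      using sub by (metis double_diff order_refl)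
  qed (use sub in blast)
qed


section \<open>Irreducible components\<close>

definition irreducible_subset :: "'p topology \<Rightarrow> 'p set \<Rightarrow> bool" where
  "irreducible_subset T S \<longleftrightarrow>
     S \<subseteq> topspace T \<and> S \<noteq> {} \<and>
     (\<forall>C D. closedin T C \<and> closedin T D \<and> S \<subseteq> C \<union> D \<longrightarrow> S \<subseteq> C \<or> S \<subseteq> D)"

definition irreducible_component :: "'p topology \<Rightarrow> 'p set \<Rightarrow> bool" where
  "irreducible_component T S \<longleftrightarrow>
     irreducible_subset T S \<and> (\<forall>S'. irreducible_subset T S' \<and> S \<subseteq> S' \<longrightarrow> S' = S)"


section \<open>Leibniz superalgebra laws as structure constants\<close>

datatype gen = X nat | Y nat

fun deg :: "gen \<Rightarrow> nat" where
  "deg (X i) = 0"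
| "deg (Y i) = 1"

definition gens :: "nat \<Rightarrow> nat \<Rightarrow> gen set" where
  "gens n m = X ` {1..n} \<union> Y ` {1..m}"

text \<open>A vector is its coordinate function; the degrees \<open>0\<close> and \<open>1\<close> represent the integers mod 2.\<close>

definition gr_space :: "nat \<Rightarrow> nat \<Rightarrow> (gen \<Rightarrow> 'a::zero) set" where
  "gr_space n m = {v. \<forall>i. i \<notin> gens n m \<longrightarrow> v i = 0}"

definition homog :: "nat \<Rightarrow> nat \<Rightarrow> nat \<Rightarrow> (gen \<Rightarrow> 'a::zero) set" where
  "homog n m a = {v \<in> gr_space n m. \<forall>i. v i \<noteq> 0 \<longrightarrow> deg i = a}"

definition basis_vec :: "gen \<Rightarrow> gen \<Rightarrow> 'a::zero_neq_one" where
  "basis_vec i = (\<lambda>j. if j = i then 1 else 0)"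

definition smul :: "'a::times \<Rightarrow> (gen \<Rightarrow> 'a) \<Rightarrow> gen \<Rightarrow> 'a" where
  "smul s v = (\<lambda>i. s * v i)"

text \<open>
  The coordinate \<open>\<mu> (i, j, k)\<close> of a point is the coefficient of the \<open>k\<close>-th basis vector in the
  product of the \<open>i\<close>-th and the \<open>j\<close>-th one.
\<close>

definition coords :: "nat \<Rightarrow> nat \<Rightarrow> (gen \<times> gen \<times> gen) set" where
  "coords n m = gens n m \<times> gens n m \<times> gens n m"

definition bracket ::
    "nat \<Rightarrow> nat \<Rightarrow> (gen \<times> gen \<times> gen \<Rightarrow> 'a::comm_ring_1) \<Rightarrow>
     (gen \<Rightarrow> 'a) \<Rightarrow> (gen \<Rightarrow> 'a) \<Rightarrow> gen \<Rightarrow> 'a" where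
  "bracket n m \<mu> u v = (\<lambda>k. \<Sum>i\<in>gens n m. \<Sum>j\<in>gens n m. u i * v j * \<mu> (i, j, k))"

definition structure_constants ::
    "nat \<Rightarrow> nat \<Rightarrow> (gen \<Rightarrow> gen \<Rightarrow> gen \<Rightarrow> 'a::zero) \<Rightarrow> gen \<times> gen \<times> gen \<Rightarrow> 'a" where
  "structure_constants n m P = (\<lambda>(i, j, k). if (i, j, k) \<in> coords n m then P i j k else 0)"

definition Leib :: "nat \<Rightarrow> nat \<Rightarrow> (gen \<times> gen \<times> gen \<Rightarrow> 'a::comm_ring_1) set" where
  "Leib n m = {\<mu> \<in> affine_space (coords n m).
     (\<forall>a\<in>{0, 1}. \<forall>b\<in>{0, 1}. \<forall>u\<in>homog n m a. \<forall>v\<in>homog n m b.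
        bracket n m \<mu> u v \<in> homog n m ((a + b) mod 2)) \<and>
     (\<forall>a\<in>{0, 1}. \<forall>b\<in>{0, 1}. \<forall>x\<in>gr_space n m. \<forall>y\<in>homog n m a. \<forall>z\<in>homog n m b.
        bracket n m \<mu> x (bracket n m \<mu> y z) =
          bracket n m \<mu> (bracket n m \<mu> x y) z
            - smul ((- 1) ^ (a * b)) (bracket n m \<mu> (bracket n m \<mu> x z) y))}"


section \<open>Group action and orbits\<close>

text \<open>Only the restriction of \<open>f\<close> to \<open>gr_space n m\<close> matters.\<close>

definition graded_GL :: "nat \<Rightarrow> nat \<Rightarrow> ((gen \<Rightarrow> 'a::field) \<Rightarrow> gen \<Rightarrow> 'a) set" where
  "graded_GL n m = {f. bij_betw f (gr_space n m) (gr_space n m) \<and>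
     (\<forall>u\<in>gr_space n m. \<forall>v\<in>gr_space n m. f (u + v) = f u + f v) \<and>
     (\<forall>s. \<forall>v\<in>gr_space n m. f (smul s v) = smul s (f v)) \<and>
     (\<forall>a\<in>{0, 1}. f ` homog n m a \<subseteq> homog n m a)}"

definition act ::
    "nat \<Rightarrow> nat \<Rightarrow> ((gen \<Rightarrow> 'a::field) \<Rightarrow> gen \<Rightarrow> 'a) \<Rightarrow>
     (gen \<times> gen \<times> gen \<Rightarrow> 'a) \<Rightarrow> gen \<times> gen \<times> gen \<Rightarrow> 'a" where
  "act n m f \<mu> = structure_constants n m (\<lambda>i j.
     inv_into (gr_space n m) f (bracket n m \<mu> (f (basis_vec i)) (f (basis_vec j))))"

definition Orb ::
    "nat \<Rightarrow> nat \<Rightarrow> (gen \<times> gen \<times> gen \<Rightarrow> 'a::field) \<Rightarrow> (gen \<times> gen \<times> gen \<Rightarrow> 'a) set" where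
  "Orb n m \<mu> = (\<lambda>f. act n m f \<mu>) ` graded_GL n m"


section \<open>The two families of laws\<close>

text \<open>
  Products of basis vectors; only indices in \<open>gens n n\<close>, respectively \<open>gens n (n + 1)\<close>, are
  relevant.  Of the parameters only \<open>b 2, \<dots>, b n\<close> (\<open>c 2, \<dots>, c n\<close>) are used.
\<close>

fun nu_table :: "nat \<Rightarrow> (nat \<Rightarrow> 'a::field) \<Rightarrow> gen \<Rightarrow> gen \<Rightarrow> gen \<Rightarrow> 'a" where
  "nu_table n b (Y i) (Y j) = (if j = 1 then basis_vec (X i) else 0)"
| "nu_table n b (X i) (Y j) =
     (if j = 1 then
        if i < n then smul (1 / 2) (basis_vec (Y (i + 1)))
        else (\<Sum>k=2..n. smul (b k) (basis_vec (Y k)))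
      else 0)"
| "nu_table n b (Y i) (X j) =
     (if j = 1 then
        if i < n then basis_vec (Y (i + 1))
        else smul 2 (\<Sum>k=2..n. smul (b k) (basis_vec (Y k)))
      else 0)"
| "nu_table n b (X i) (X j) =
     (if j = 1 then
        if i < n then basis_vec (X (i + 1))
        else smul 2 (\<Sum>k=2..n. smul (b k) (basis_vec (X k)))
      else 0)"

definition nu :: "nat \<Rightarrow> (nat \<Rightarrow> 'a::field) \<Rightarrow> gen \<times> gen \<times> gen \<Rightarrow> 'a" where
  "nu n b = structure_constants n n (nu_table n b)"

fun eta_table :: "nat \<Rightarrow> (nat \<Rightarrow> 'a::field) \<Rightarrow> gen \<Rightarrow> gen \<Rightarrow> gen \<Rightarrow> 'a" where
  "eta_table n c (X i) (X j) =
     (if j = 1 then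
        if i < n then basis_vec (X (i + 1))
        else (\<Sum>k=2..n. smul (c k) (basis_vec (X k)))
      else 0)"
| "eta_table n c (Y i) (X j) =
     (if j = 1 then
        if i \<le> n then basis_vec (Y (i + 1))
        else (\<Sum>k=2..n. smul (c k) (basis_vec (Y (k + 1))))
      else 0)"
| "eta_table n c (Y i) (Y j) =
     (if j = 1 then
        if i \<le> n then basis_vec (X i)
        else (\<Sum>k=2..n. smul (c k) (basis_vec (X k)))
      else 0)"
| "eta_table n c (X i) (Y j) =
     (if j = 1 then smul (1 / 2) (basis_vec (Y (i + 1))) else 0)"

definition eta :: "nat \<Rightarrow> (nat \<Rightarrow> 'a::field) \<Rightarrow> gen \<times> gen \<times> gen \<Rightarrow> 'a" where
  "eta n c = structure_constants n (n + 1) (eta_table n c)"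

end

theory Submission
  imports Defs "Jordan_Normal_Form.Determinant" "HOL-Computational_Algebra.Polynomial"
begin

text \<open>
  Order the basis as \<open>Y 1, X 1, Y 2, X 2, \<dots>\<close> and let \<open>R\<close> be right multiplication by \<open>y = Y 1\<close>.  In
  each law of the two families \<open>y, R y, R\<^sup>2 y, \<dots>\<close> are up to scalars the basis vectors, so \<open>y\<close> is a
  cyclic vector for \<open>R\<close>.  Conversely, let a Leibniz law have an odd \<open>y\<close> that is cyclic for its right
  multiplication \<open>R\<close>.  The Leibniz identity gives that \<open>[y, y]\<close> acts on the right as \<open>2 R\<^sup>2\<close> and
  that the later elements of the sequence act by commutators of powers of \<open>R\<close>, hence by zero.  So the
  law is determined by the coordinates of the last vector \<open>R\<^sup>n\<^sup>+\<^sup>m y\<close>; as this vector acts by zero, its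
  coordinates at \<open>y\<close> and \<open>[y, y]\<close> vanish, and the law belongs to the orbit of a member of the family.
  Therefore the union \<open>W\<close> of the orbits is the set of laws with a cyclic odd element, which is the
  nonvanishing of determinants polynomial in the structure constants, so \<open>W\<close> is open in the variety.
  It is irreducible because two of its points are joined by a rational curve: move the base change
  and the parameters along straight lines and invert the base change by its adjugate.  The closure of
  a nonempty open irreducible subset is an irreducible component.
\<close>

section \<open>Algebras of functions\<close>

text \<open>Several algebras of functions occur below, both on affine space and along a line.
  Closure under determinants and adjugates is proved once for all of them.\<close>

locale fun_algebra =
  fixes A :: "('b \<Rightarrow> 'a::field) set"
  assumes const: "(\<lambda>_. c) \<in> A"
    and add: "f \<in> A \<Longrightarrow> g \<in> A \<Longrightarrow> (\<lambda>x. f x + g x) \<in> A"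
    and mult: "f \<in> A \<Longrightarrow> g \<in> A \<Longrightarrow> (\<lambda>x. f x * g x) \<in> A"
begin

lemma uminus: "f \<in> A \<Longrightarrow> (\<lambda>x. - f x) \<in> A"
  using mult[OF const[of "-1"]] by simp

lemma diff: "f \<in> A \<Longrightarrow> g \<in> A \<Longrightarrow> (\<lambda>x. f x - g x) \<in> A"
  using add[OF _ uminus] by simp

lemma sum: "(\<And>i. i \<in> K \<Longrightarrow> f i \<in> A) \<Longrightarrow> (\<lambda>x. \<Sum>i\<in>K. f i x) \<in> A"
  by (induction K rule: infinite_finite_induct) (auto intro: const add)

lemma prod: "(\<And>i. i \<in> K \<Longrightarrow> f i \<in> A) \<Longrightarrow> (\<lambda>x. \<Prod>i\<in>K. f i x) \<in> A"
  by (induction K rule: infinite_finite_induct) (auto intro: const mult)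

lemma power: "f \<in> A \<Longrightarrow> (\<lambda>x. f x ^ k) \<in> A"
  by (induction k) (auto intro: const mult)

lemma det:
  assumes "\<And>x. M x \<in> carrier_mat n n"
    and "\<And>i j. i < n \<Longrightarrow> j < n \<Longrightarrow> (\<lambda>x. M x $$ (i, j)) \<in> A"
  shows "(\<lambda>x. det (M x)) \<in> A"
proof -
  have "(\<lambda>x. det (M x)) =
      (\<lambda>x. \<Sum>p\<in>{p. p permutes {0..<n}}. signof p * (\<Prod>i\<in>{0..<n}. M x $$ (i, p i)))"
    using det_def'[OF assms(1)] by (intro ext)
  also have "\<dots> \<in> A"
    by (intro sum mult prod const assms(2)) (auto simp: permutes_in_image)
  finally show ?thesis .
qed

text \<open>Each entry of the adjugate is a signed minor, hence a determinant to which
  \<open>det\<close> applies.\<close>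

lemma adj_mat:
  assumes M: "\<And>x. M x \<in> carrier_mat n n"
    and "\<And>i j. i < n \<Longrightarrow> j < n \<Longrightarrow> (\<lambda>x. M x $$ (i, j)) \<in> A"
    and ij: "i < n" "j < n"
  shows "(\<lambda>x. adj_mat (M x) $$ (i, j)) \<in> A"
proof -
  have "(\<lambda>x. adj_mat (M x) $$ (i, j)) = (\<lambda>x. (- 1) ^ (j + i) * det (mat_delete (M x) j i))"
    using ij carrier_matD[OF M] by (auto simp: adj_mat_def cofactor_def)
  also have "\<dots> \<in> A"
  proof (intro mult const det)
    show "mat_delete (M x) j i \<in> carrier_mat (n - 1) (n - 1)" for x
      using mat_delete_carrier[OF M] .
    fix k l assume kl: "k < n - 1" "l < n - 1"
    have "(\<lambda>x. mat_delete (M x) j i $$ (k, l)) =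
        (\<lambda>x. M x $$ (if k < j then k else Suc k, if l < i then l else Suc l))"
      using kl carrier_matD[OF M] by (auto simp: mat_delete_def)
    then show "(\<lambda>x. mat_delete (M x) j i $$ (k, l)) \<in> A"
      using kl by (simp only:) (intro assms(2), auto)
  qed
  finally show ?thesis .
qed

end

section \<open>Polynomial functions on affine space and polynomials in one parameter\<close>

definition polynomial_functions :: "'v set \<Rightarrow> (('v \<Rightarrow> 'a::field) \<Rightarrow> 'a) set" where
  "polynomial_functions I = {g. \<exists>p\<in>polynomials I. g = poly_eval p}"

lemma polynomials_add: "p \<in> polynomials I \<Longrightarrow> q \<in> polynomials I \<Longrightarrow> p + q \<in> polynomials I"
  unfolding polynomials_def using Poly_Mapping.keys_add[of p q] by fast

interpretation polyfun: fun_algebra "polynomial_functions I :: (('v \<Rightarrow> 'a::field) \<Rightarrow> 'a) set" for I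
proof
  show "(\<lambda>_. c) \<in> polynomial_functions I" for c :: 'a
    unfolding polynomial_functions_def
    by (intro CollectI bexI[of _ "Poly_Mapping.single 0 c"])
       (auto simp: poly_eval_single monomial_eval_def polynomials_def)
  show "(\<lambda>x. f x + g x) \<in> polynomial_functions I"
    if "f \<in> polynomial_functions I" "g \<in> polynomial_functions I" for f g :: "('v \<Rightarrow> 'a) \<Rightarrow> 'a"
    using that unfolding polynomial_functions_def
    by (fastforce intro: polynomials_add simp flip: poly_eval_add)
  show "(\<lambda>x. f x * g x) \<in> polynomial_functions I"
    if "f \<in> polynomial_functions I" "g \<in> polynomial_functions I" for f g :: "('v \<Rightarrow> 'a) \<Rightarrow> 'a"
    using that unfolding polynomial_functions_def
    by (fastforce intro: polynomials_mult simp flip: poly_eval_mult)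
qed

lemma polynomial_functions_coord:
  assumes "v \<in> I"
  shows "(\<lambda>x. x v) \<in> (polynomial_functions I :: (('v \<Rightarrow> 'a::field) \<Rightarrow> 'a) set)"
  unfolding polynomial_functions_def using assms
  by (intro CollectI bexI[of _ "Poly_Mapping.single (Poly_Mapping.single v 1) 1"])
     (auto simp: poly_eval_single monomial_eval_def polynomials_def)

text \<open>One coordinate of a polynomial curve. As functions these fall under
  \<open>fun_algebra\<close>; the formal \<open>poly\<close> is recovered only when infinitely many
  zeros must force it to vanish.\<close>

definition polynomial_paths :: "('a \<Rightarrow> 'a::field) set" where
  "polynomial_paths = range poly"

interpretation polypath: fun_algebra "polynomial_paths :: ('a \<Rightarrow> 'a::field) set"
proof
  show "(\<lambda>_. c) \<in> polynomial_paths" for c :: 'a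
    unfolding polynomial_paths_def by (rule range_eqI[of _ _ "[:c:]"]) auto
  show "(\<lambda>x. f x + g x) \<in> polynomial_paths"
    if "f \<in> polynomial_paths" "g \<in> polynomial_paths" for f g :: "'a \<Rightarrow> 'a"
    using that unfolding polynomial_paths_def
    by (clarsimp simp flip: poly_add)
  show "(\<lambda>x. f x * g x) \<in> polynomial_paths"
    if "f \<in> polynomial_paths" "g \<in> polynomial_paths" for f g :: "'a \<Rightarrow> 'a"
    using that unfolding polynomial_paths_def
    by (clarsimp simp flip: poly_mult)
qed

lemma polynomial_path_id: "(\<lambda>t. t) \<in> polynomial_paths"
  unfolding polynomial_paths_def by (rule range_eqI[of _ _ "[:0, 1:]"]) auto

text \<open>Denominators are cleared: along a curve with common denominator \<open>d\<close>, a
  polynomial becomes a polynomial in the parameter after multiplication by a power of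
  \<open>d\<close>.\<close>

lemma polynomial_along_rational_path:
  fixes d :: "'a::field \<Rightarrow> 'a" and w :: "'v \<Rightarrow> 'a \<Rightarrow> 'a"
  assumes d: "d \<in> polynomial_paths" and w: "\<And>v. w v \<in> polynomial_paths"
  shows "\<exists>P K. P \<in> polynomial_paths \<and>
    (\<forall>t. d t \<noteq> 0 \<longrightarrow> poly_eval p (\<lambda>v. w v t / d t) * d t ^ K = P t)"
proof -
  \<comment> \<open>\<open>B\<close> consists of the functions that are polynomial up to a power of
    \<open>d\<close>. It is an algebra and contains the coordinates of the curve, hence also every
    polynomial in them.\<close>
  define B where
    "B = {g. \<exists>P K. P \<in> polynomial_paths \<and> (\<forall>t. d t \<noteq> 0 \<longrightarrow> g t * d t ^ K = P t)}"
  interpret B: fun_algebra B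
  proof
    show "(\<lambda>_. c) \<in> B" for c
      unfolding B_def by (intro CollectI exI[of _ "\<lambda>_. c"] exI[of _ 0]) (auto intro: polypath.const)
  next
    fix f g assume "f \<in> B" "g \<in> B"
    from \<open>f \<in> B\<close> obtain P K where "P \<in> polynomial_paths" "\<forall>t. d t \<noteq> 0 \<longrightarrow> f t * d t ^ K = P t"
      unfolding B_def by blast
    moreover from \<open>g \<in> B\<close> obtain Q L
      where "Q \<in> polynomial_paths" "\<forall>t. d t \<noteq> 0 \<longrightarrow> g t * d t ^ L = Q t"
      unfolding B_def by blast
    ultimately have *: "P \<in> polynomial_paths" "Q \<in> polynomial_paths"
      "\<And>t. d t \<noteq> 0 \<Longrightarrow> P t = f t * d t ^ K" "\<And>t. d t \<noteq> 0 \<Longrightarrow> Q t = g t * d t ^ L"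
      by auto
    \<comment> \<open>Over the common denominator \<open>d ^ (K + L)\<close> the two numerators are
      crosswise multiplied by the missing powers.\<close>
    have "(\<lambda>t. P t * d t ^ L + Q t * d t ^ K) \<in> polynomial_paths"
      using * d by (intro polypath.add polypath.mult polypath.power)
    then show "(\<lambda>t. f t + g t) \<in> B"
      unfolding B_def
      by (intro CollectI exI[of _ "\<lambda>t. P t * d t ^ L + Q t * d t ^ K"] exI[of _ "K + L"])
         (simp add: * power_add algebra_simps)
    have "(\<lambda>t. P t * Q t) \<in> polynomial_paths"
      using * by (intro polypath.mult)
    then show "(\<lambda>t. f t * g t) \<in> B"
      unfolding B_def
      by (intro CollectI exI[of _ "\<lambda>t. P t * Q t"] exI[of _ "K + L"])
         (simp add: * power_add algebra_simps)
  qed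
  have "(\<lambda>t. w v t / d t) \<in> B" for v
    unfolding B_def using w by (intro CollectI exI[of _ "w v"] exI[of _ 1]) simp
  then have "(\<lambda>t. poly_eval p (\<lambda>v. w v t / d t)) \<in> B"
    unfolding poly_eval_def monomial_eval_def
    by (intro B.sum B.mult B.const B.prod B.power)
  then show ?thesis unfolding B_def by auto
qed

section \<open>Zariski topology\<close>

lemma closedin_zariski_polynomial_functions:
  assumes "G \<subseteq> polynomial_functions I"
  shows "closedin (zariski I) {x \<in> affine_space I. \<forall>g\<in>G. g x = 0}"
proof -
  have "{x \<in> affine_space I. \<forall>g\<in>G. g x = 0} = zero_locus I {p \<in> polynomials I. poly_eval p \<in> G}"
    using assms unfolding zero_locus_def polynomial_functions_def by fastforce
  moreover have "{p \<in> polynomials I. poly_eval p \<in> G} \<subseteq> polynomials I" by simp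
  ultimately show ?thesis unfolding closedin_zariski by metis
qed

lemma zariski_separating_polynomial:
  assumes "closedin (zariski I) C" "x \<in> affine_space I" "x \<notin> C"
  obtains p where "\<And>u. u \<in> C \<Longrightarrow> poly_eval p u = 0" "poly_eval p x \<noteq> 0"
  using assms unfolding closedin_zariski zero_locus_def by blast

text \<open>If closed sets \<open>C\<close> and \<open>D\<close> cover \<open>W\<close> and neither
  contains it, take polynomials vanishing on \<open>C\<close> and on \<open>D\<close> but not at
  \<open>u1\<close> and \<open>u2\<close> respectively. On a rational curve in \<open>W\<close> from
  \<open>u1\<close> to \<open>u2\<close> their product vanishes, although neither factor does
  identically. This is impossible over an infinite field.\<close>

lemma irreducible_subset_zariski_if_rational_paths:
  fixes W :: "('v \<Rightarrow> 'a::field_char_0) set"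
  assumes W: "W \<subseteq> affine_space I" "W \<noteq> {}"
    and path: "\<And>u1 u2. u1 \<in> W \<Longrightarrow> u2 \<in> W \<Longrightarrow>
      \<exists>d w. d \<in> polynomial_paths \<and> (\<forall>v. w v \<in> polynomial_paths) \<and> d 0 \<noteq> 0 \<and> d 1 \<noteq> 0 \<and>
        (\<lambda>v. w v 0 / d 0) = u1 \<and> (\<lambda>v. w v 1 / d 1) = u2 \<and>
        (\<forall>t. d t \<noteq> 0 \<longrightarrow> (\<lambda>v. w v t / d t) \<in> W)"
  shows "irreducible_subset (zariski I) W"
  unfolding irreducible_subset_def topspace_zariski
proof (intro conjI W allI impI)
  fix C D assume CD: "closedin (zariski I) C \<and> closedin (zariski I) D \<and> W \<subseteq> C \<union> D"
  show "W \<subseteq> C \<or> W \<subseteq> D"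
  proof (rule ccontr)
    assume "\<not> (W \<subseteq> C \<or> W \<subseteq> D)"
    then obtain u1 u2 where u: "u1 \<in> W" "u1 \<notin> C" "u2 \<in> W" "u2 \<notin> D" by blast
    obtain p where p: "\<And>u. u \<in> C \<Longrightarrow> poly_eval p u = 0" "poly_eval p u1 \<noteq> 0"
      using zariski_separating_polynomial[of I C u1] CD u W by blast
    obtain q where q: "\<And>u. u \<in> D \<Longrightarrow> poly_eval q u = 0" "poly_eval q u2 \<noteq> 0"
      using zariski_separating_polynomial[of I D u2] CD u W by blast
    obtain d w where dw: "d \<in> polynomial_paths" "\<And>v. w v \<in> polynomial_paths" "d 0 \<noteq> 0" "d 1 \<noteq> 0"
      "(\<lambda>v. w v 0 / d 0) = u1" "(\<lambda>v. w v 1 / d 1) = u2"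
      "\<And>t. d t \<noteq> 0 \<Longrightarrow> (\<lambda>v. w v t / d t) \<in> W"
      using path[OF u(1,3)] by blast
    obtain P K where P: "P \<in> polynomial_paths"
      "\<And>t. d t \<noteq> 0 \<Longrightarrow> P t = poly_eval p (\<lambda>v. w v t / d t) * d t ^ K"
      using polynomial_along_rational_path[of d w p] dw by metis
    obtain Q L where Q: "Q \<in> polynomial_paths"
      "\<And>t. d t \<noteq> 0 \<Longrightarrow> Q t = poly_eval q (\<lambda>v. w v t / d t) * d t ^ L"
      using polynomial_along_rational_path[of d w q] dw by metis
    obtain p' q' d' where pqd: "P = poly p'" "Q = poly q'" "d = poly d'"
      using P Q dw(1) unfolding polynomial_paths_def by auto
    \<comment> \<open>The factor \<open>d'\<close> takes care of the parameters at which the curve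
      is undefined, so that the product vanishes at every \<open>t\<close>.\<close>
    have "poly (p' * q' * d') t = 0" for t
    proof (cases "d t = 0")
      case False
      then have "(\<lambda>v. w v t / d t) \<in> C \<union> D" using dw(7) CD by blast
      then have "P t = 0 \<or> Q t = 0"
        using p(1) q(1) P(2)[OF False] Q(2)[OF False] by auto
      then show ?thesis unfolding pqd by auto
    qed (simp add: pqd)
    then have "p' * q' * d' = 0"
      using poly_all_0_iff_0 by blast
    \<comment> \<open>The curve starts at \<open>u1\<close>, where \<open>p\<close> does not vanish,
      and ends at \<open>u2\<close>, where \<open>q\<close> does not vanish.\<close>
    moreover have "p' \<noteq> 0" using P(2)[of 0] dw(3,5) p(2) unfolding pqd by auto
    moreover have "q' \<noteq> 0" using Q(2)[of 1] dw(4,6) q(2) unfolding pqd by auto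
    moreover have "d' \<noteq> 0" using dw(3) unfolding pqd by auto
    ultimately show False by simp
  qed
qed

text \<open>\<open>W\<close> is open in \<open>L\<close>, its complement there being
  \<open>L \<inter> F\<close>. An irreducible set above the closure of \<open>W\<close> is covered
  by this closure and \<open>L \<inter> F\<close>; it meets \<open>W\<close>, so it cannot lie in
  the latter.\<close>

lemma irreducible_component_closure_of:
  assumes L: "closedin T L" and W: "irreducible_subset T W" "W \<subseteq> L"
    and openW: "closedin T F" "W = L - F"
  shows "irreducible_component (subtopology T L) (T closure_of W)"
proof -
  have LT: "L \<subseteq> topspace T" using L closedin_subset by blast
  then have top: "topspace (subtopology T L) = L" by (simp add: topspace_subtopology inf_absorb2)
  have clL: "T closure_of W \<subseteq> L" using W(2) L closure_of_minimal by blast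
  have WT: "W \<subseteq> topspace T" and Wne: "W \<noteq> {}" using W unfolding irreducible_subset_def by auto
  have Wcl: "W \<subseteq> T closure_of W" using WT by (rule closure_of_subset)
  have closed: "closedin (subtopology T L) C \<longleftrightarrow> closedin T C \<and> C \<subseteq> L" for C
    using L closedin_closed_subtopology by blast
  \<comment> \<open>Irreducibility passes to the closure, since a closed set containing
    \<open>W\<close> contains its closure.\<close>
  have irr: "irreducible_subset (subtopology T L) (T closure_of W)"
    unfolding irreducible_subset_def top closed
  proof (intro conjI clL allI impI)
    show "T closure_of W \<noteq> {}" using Wcl Wne by blast
    fix C D assume CD: "(closedin T C \<and> C \<subseteq> L) \<and> (closedin T D \<and> D \<subseteq> L) \<and> T closure_of W \<subseteq> C \<union> D"
    then have "closedin T C \<and> closedin T D \<and> W \<subseteq> C \<union> D"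
      using Wcl by auto
    then have "W \<subseteq> C \<or> W \<subseteq> D"
      using W(1) unfolding irreducible_subset_def by simp
    then show "T closure_of W \<subseteq> C \<or> T closure_of W \<subseteq> D"
      using CD closure_of_minimal by blast
  qed
  show ?thesis
    unfolding irreducible_component_def
  proof (intro conjI irr allI impI)
    fix S assume S: "irreducible_subset (subtopology T L) S \<and> T closure_of W \<subseteq> S"
    have "S \<subseteq> T closure_of W \<union> (L \<inter> F)"
      using S Wcl unfolding irreducible_subset_def top openW(2) by blast
    moreover have "closedin (subtopology T L) (T closure_of W)" "closedin (subtopology T L) (L \<inter> F)"
      unfolding closed using clL L openW(1) by auto
    ultimately have "S \<subseteq> T closure_of W \<or> S \<subseteq> L \<inter> F"
      using S unfolding irreducible_subset_def by blast
    moreover have "\<not> S \<subseteq> L \<inter> F" using S Wcl Wne openW(2) by blast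
    ultimately show "S = T closure_of W" using S by blast
  qed
qed

section \<open>Linear maps and isomorphisms\<close>

lemma finite_gens: "finite (gens n m)"
  unfolding gens_def by simp

lemma gr_space_sum:
  assumes "\<And>j. j \<in> J \<Longrightarrow> v j \<in> gr_space n m"
  shows "(\<lambda>k. \<Sum>j\<in>J. c j * (v j k :: 'a::comm_ring_1)) \<in> gr_space n m"
  using assms unfolding gr_space_def by simp

text \<open>The hypothesis is a disjunction because the summands of the wrong degree are allowed
  when their coefficient vanishes, as happens in the expansion of a homogeneous vector.\<close>

lemma homog_sum:
  assumes "\<And>j. j \<in> J \<Longrightarrow> c j = 0 \<or> v j \<in> homog n m a"
  shows "(\<lambda>k. \<Sum>j\<in>J. c j * (v j k :: 'a::comm_ring_1)) \<in> homog n m a"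
proof -
  have "(\<Sum>j\<in>J. c j * v j k) = 0" if "k \<notin> gens n m \<or> deg k \<noteq> a" for k
  proof (intro sum.neutral ballI)
    fix j assume "j \<in> J"
    then have "c j = 0 \<or> v j k = 0"
      using assms[of j] that unfolding homog_def gr_space_def by blast
    then show "c j * v j k = 0" by auto
  qed
  then show ?thesis unfolding homog_def gr_space_def by blast
qed

lemma homog_subset: "homog n m a \<subseteq> gr_space n m"
  unfolding homog_def by auto

lemma gr_space_0: "0 \<in> gr_space n m"
  and gr_space_add: "u \<in> gr_space n m \<Longrightarrow> v \<in> gr_space n m \<Longrightarrow> u + v \<in> gr_space n m"
  and gr_space_smul: "u \<in> gr_space n m \<Longrightarrow> smul s u \<in> gr_space n m"
  for u v :: "gen \<Rightarrow> 'a::comm_ring_1"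
  unfolding gr_space_def smul_def by auto

lemma homog_smul: "u \<in> homog n m a \<Longrightarrow> smul s u \<in> homog n m a" for u :: "gen \<Rightarrow> 'a::comm_ring_1"
  unfolding homog_def gr_space_def smul_def by force

lemma homog_add:
  fixes u v :: "gen \<Rightarrow> 'a::comm_ring_1"
  assumes "u \<in> homog n m a" "v \<in> homog n m a"
  shows "u + v \<in> homog n m a"
proof -
  have "(u + v) i = 0" if "i \<notin> gens n m \<or> deg i \<noteq> a" for i
  proof -
    have "u i = 0" "v i = 0" using assms that unfolding homog_def gr_space_def by blast+
    then show ?thesis by simp
  qed
  then show ?thesis unfolding homog_def gr_space_def by blast
qed

lemma smul_simps:
  "smul a (smul b u) = smul (a * b) u" "smul 1 u = u" "smul 0 u = 0" "smul a 0 = 0" "smul a (\<lambda>_. 0) = 0"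
  for u :: "gen \<Rightarrow> 'a::comm_ring_1"
  by (auto simp: smul_def mult.assoc)

lemma sum_smul: "(\<Sum>k\<in>K. smul (c k) (v k)) = (\<lambda>g. \<Sum>k\<in>K. c k * v k g)"
  for v :: "'b \<Rightarrow> gen \<Rightarrow> 'a::comm_ring_1"
  by (induction K rule: infinite_finite_induct) (auto simp: smul_def)

lemma basis_vec_homog: "g \<in> gens n m \<Longrightarrow> deg g = a \<Longrightarrow> basis_vec g \<in> homog n m a"
  unfolding homog_def gr_space_def basis_vec_def by auto

lemma basis_vec_gr_space: "g \<in> gens n m \<Longrightarrow> basis_vec g \<in> gr_space n m"
  unfolding gr_space_def basis_vec_def by auto

lemma sum_basis_vec: "finite J \<Longrightarrow> (\<Sum>g\<in>J. c g * basis_vec g k) = (if k \<in> J then c k else (0::'a::comm_ring_1))"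
  unfolding basis_vec_def by (simp add: if_distrib[of "(*) _"] cong: if_cong)

lemma basis_expansion:
  assumes "u \<in> gr_space n m"
  shows "u = (\<lambda>k. \<Sum>g\<in>gens n m. u g * (basis_vec g k :: 'a::comm_ring_1))"
  using assms by (auto simp: sum_basis_vec finite_gens gr_space_def)

section \<open>Linear endomorphisms of the graded space\<close>

definition linear_on_gr :: "nat \<Rightarrow> nat \<Rightarrow> ((gen \<Rightarrow> 'a::comm_ring_1) \<Rightarrow> gen \<Rightarrow> 'a) \<Rightarrow> bool" where
  "linear_on_gr n m f \<longleftrightarrow> (\<forall>u\<in>gr_space n m. f u \<in> gr_space n m) \<and>
     (\<forall>u\<in>gr_space n m. \<forall>v\<in>gr_space n m. f (u + v) = f u + f v) \<and>
     (\<forall>s. \<forall>v\<in>gr_space n m. f (smul s v) = smul s (f v))"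

lemma linear_on_gr_sum:
  assumes f: "linear_on_gr n m f" and v: "\<And>j. j \<in> J \<Longrightarrow> v j \<in> gr_space n m"
  shows "f (\<lambda>k. \<Sum>j\<in>J. c j * v j k) = (\<lambda>k. \<Sum>j\<in>J. c j * f (v j) k)"
proof -
  \<comment> \<open>Homogeneity at the scalar 0 yields \<open>f 0 = 0\<close>, which the empty sum
    and the sum over an infinite set require.\<close>
  have "f (smul 0 0) = smul 0 (f 0)"
    using f gr_space_0 unfolding linear_on_gr_def by blast
  then have f0: "f (\<lambda>k. 0) = (\<lambda>k. 0)"
    by (simp add: smul_def zero_fun_def)
  show ?thesis
    using v
  proof (induction J rule: infinite_finite_induct)
    case (insert i J)
    have "f (\<lambda>k. \<Sum>j\<in>insert i J. c j * v j k) = f (smul (c i) (v i) + (\<lambda>k. \<Sum>j\<in>J. c j * v j k))"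
      using insert by (intro arg_cong[of _ _ f]) (auto simp: smul_def plus_fun_def)
    also have "\<dots> = smul (c i) (f (v i)) + f (\<lambda>k. \<Sum>j\<in>J. c j * v j k)"
      using f gr_space_sum[of J v n m c] gr_space_smul[of "v i" n m "c i"] insert.prems
      unfolding linear_on_gr_def by simp
    finally show ?case
      using insert by (auto simp: smul_def plus_fun_def)
  qed (simp_all add: f0)
qed

lemma linear_on_gr_expansion:
  assumes "linear_on_gr n m f" "u \<in> gr_space n m"
  shows "f u = (\<lambda>k. \<Sum>g\<in>gens n m. u g * f (basis_vec g) k)"
  by (subst basis_expansion[OF assms(2)], rule linear_on_gr_sum[OF assms(1)])
     (rule basis_vec_gr_space)

lemma linear_on_gr_eqI:
  assumes "linear_on_gr n m f" "linear_on_gr n m h"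
    and "\<And>g. g \<in> gens n m \<Longrightarrow> f (basis_vec g) = h (basis_vec g)" and u: "u \<in> gr_space n m"
  shows "f u = h u"
  unfolding linear_on_gr_expansion[OF assms(1) u] linear_on_gr_expansion[OF assms(2) u]
  using assms(3) by (intro ext sum.cong) auto

lemma linear_on_gr_comp:
  "linear_on_gr n m f \<Longrightarrow> linear_on_gr n m h \<Longrightarrow> linear_on_gr n m (\<lambda>u. f (h u))"
  unfolding linear_on_gr_def by simp

lemma linear_on_grI:
  assumes "\<And>u. u \<in> gr_space n m \<Longrightarrow> f u = (\<lambda>k. \<Sum>g\<in>gens n m. u g * v g k)"
    and "\<And>g. g \<in> gens n m \<Longrightarrow> v g \<in> gr_space n m"
  shows "linear_on_gr n m f"
  unfolding linear_on_gr_def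
proof (intro conjI ballI allI)
  show "f u \<in> gr_space n m" if "u \<in> gr_space n m" for u
    unfolding assms(1)[OF that] using assms(2) by (rule gr_space_sum)
  show "f (u + w) = f u + f w" if "u \<in> gr_space n m" "w \<in> gr_space n m" for u w
    using that gr_space_add[of u n m w]
    by (auto simp: assms(1) plus_fun_def sum.distrib algebra_simps)
  show "f (smul s u) = smul s (f u)" if "u \<in> gr_space n m" for s u
    using that gr_space_smul[of u n m s]
    by (auto simp: assms(1) smul_def sum_distrib_left algebra_simps)
qed

section \<open>Bilinearity of the bracket\<close>

lemma bracket_gr_space:
  assumes "\<mu> \<in> affine_space (coords n m)"
  shows "bracket n m \<mu> u v \<in> gr_space n m"
  using assms unfolding gr_space_def bracket_def affine_space_def coords_def by simp

lemma bracket_linear_left: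
  assumes "\<mu> \<in> affine_space (coords n m)"
  shows "linear_on_gr n m (\<lambda>u. bracket n m \<mu> u v)"
proof (rule linear_on_grI)
  show "bracket n m \<mu> u v =
      (\<lambda>k. \<Sum>i\<in>gens n m. u i * (\<lambda>k. \<Sum>j\<in>gens n m. v j * \<mu> (i, j, k)) k)" for u
    unfolding bracket_def by (simp add: sum_distrib_left mult.assoc)
  show "(\<lambda>k. \<Sum>j\<in>gens n m. v j * \<mu> (i, j, k)) \<in> gr_space n m" for i
    using assms unfolding gr_space_def affine_space_def coords_def by simp
qed

lemma bracket_linear_right:
  assumes "\<mu> \<in> affine_space (coords n m)"
  shows "linear_on_gr n m (bracket n m \<mu> u)"
proof (rule linear_on_grI)
  show "bracket n m \<mu> u v =
      (\<lambda>k. \<Sum>j\<in>gens n m. v j * (\<lambda>k. \<Sum>i\<in>gens n m. u i * \<mu> (i, j, k)) k)" for v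
    unfolding bracket_def by (subst sum.swap) (simp add: sum_distrib_left mult_ac)
  show "(\<lambda>k. \<Sum>i\<in>gens n m. u i * \<mu> (i, j, k)) \<in> gr_space n m" for j
    using assms unfolding gr_space_def affine_space_def coords_def by simp
qed

lemma
  assumes "\<mu> \<in> affine_space (coords n m)" "u \<in> gr_space n m"
  shows bracket_smul_left: "bracket n m \<mu> (smul s u) v = smul s (bracket n m \<mu> u v)"
    and bracket_smul_right: "bracket n m \<mu> v (smul s u) = smul s (bracket n m \<mu> v u)"
  using assms bracket_linear_left[OF assms(1)] bracket_linear_right[OF assms(1)]
  unfolding linear_on_gr_def by auto

lemma bracket_0_left: "bracket n m \<mu> 0 v = 0"
  unfolding bracket_def by auto

lemma bracket_basis:
  assumes "i \<in> gens n m" "j \<in> gens n m"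
  shows "bracket n m \<mu> (basis_vec i) (basis_vec j) k = \<mu> (i, j, k)"
proof -
  have "bracket n m \<mu> (basis_vec i) (basis_vec j) k =
      (\<Sum>i'\<in>gens n m. \<Sum>j'\<in>gens n m. if i' = i then if j' = j then \<mu> (i', j', k) else 0 else 0)"
    unfolding bracket_def basis_vec_def by (intro sum.cong) auto
  also have "\<dots> = (\<Sum>i'\<in>gens n m. if i' = i then \<mu> (i', j, k) else 0)"
    using assms finite_gens by (intro sum.cong) (auto simp: sum.delta)
  finally show ?thesis using assms finite_gens by (simp add: sum.delta)
qed

section \<open>Degree-preserving automorphisms\<close>

lemma graded_GL_linear:
  assumes "f \<in> graded_GL n m"
  shows "linear_on_gr n m f"
  using assms bij_betw_apply[of f "gr_space n m" "gr_space n m"]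
  unfolding graded_GL_def linear_on_gr_def by simp

lemma graded_GL_homog:
  "f \<in> graded_GL n m \<Longrightarrow> u \<in> homog n m a \<Longrightarrow> a \<in> {0, 1} \<Longrightarrow> f u \<in> homog n m a"
  unfolding graded_GL_def by blast

lemma graded_GLI:
  assumes "linear_on_gr n m f" "bij_betw f (gr_space n m) (gr_space n m)"
    and "\<And>g. g \<in> gens n m \<Longrightarrow> f (basis_vec g) \<in> homog n m (deg g)"
  shows "f \<in> graded_GL n m"
proof -
  have "f u \<in> homog n m a" if u: "u \<in> homog n m a" for u a
  proof -
    have "u g = 0 \<or> f (basis_vec g) \<in> homog n m a" if "g \<in> gens n m" for g
      using assms(3)[OF that] u unfolding homog_def by auto
    then have "(\<lambda>k. \<Sum>g\<in>gens n m. u g * f (basis_vec g) k) \<in> homog n m a"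
      by (rule homog_sum)
    then show ?thesis
      using linear_on_gr_expansion[OF assms(1), of u] u homog_subset[of n m a] by auto
  qed
  then show ?thesis
    using assms(1,2) unfolding graded_GL_def linear_on_gr_def by auto
qed

text \<open>Linearity of the inverse is formal. That it preserves degrees follows by splitting the
  preimage of a basis vector into its homogeneous parts.\<close>

lemma graded_GL_inv_into:
  assumes f: "f \<in> graded_GL n m"
  shows "inv_into (gr_space n m) f \<in> graded_GL n m"
proof -
  let ?V = "gr_space n m" and ?h = "inv_into (gr_space n m) f"
  have bij: "bij_betw f ?V ?V" and lin: "linear_on_gr n m f"
    using f graded_GL_linear unfolding graded_GL_def by auto
  have h: "?h u \<in> ?V" "f (?h u) = u" if "u \<in> ?V" for u
    using that bij by (auto simp: bij_betw_def inv_into_into f_inv_into_f)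
  have inj: "u = v" if "f u = f v" "u \<in> ?V" "v \<in> ?V" for u v
    using that bij unfolding bij_betw_def inj_on_def by blast
  have hlin: "linear_on_gr n m ?h"
    unfolding linear_on_gr_def
  proof (intro conjI ballI allI)
    show "?h (u + v) = ?h u + ?h v" if uv: "u \<in> ?V" "v \<in> ?V" for u v
    proof (rule inj)
      have "f (?h u + ?h v) = f (?h u) + f (?h v)"
        using lin h(1)[OF uv(1)] h(1)[OF uv(2)] unfolding linear_on_gr_def by blast
      then show "f (?h (u + v)) = f (?h u + ?h v)"
        by (simp only: h(2) uv gr_space_add)
    qed (intro h(1) gr_space_add uv)+
    show "?h (smul s u) = smul s (?h u)" if u: "u \<in> ?V" for u s
    proof (rule inj)
      have "f (smul s (?h u)) = smul s (f (?h u))"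
        using lin h(1)[OF u] unfolding linear_on_gr_def by blast
      then show "f (?h (smul s u)) = f (smul s (?h u))"
        by (simp only: h(2) u gr_space_smul)
    qed (intro h(1) gr_space_smul u)+
  qed (rule h)
  show ?thesis
  proof (rule graded_GLI[OF hlin])
    show "bij_betw ?h ?V ?V" using bij by (rule bij_betw_inv_into)
    fix g assume g: "g \<in> gens n m"
    define w where "w = ?h (basis_vec g)"
    define w0 where "w0 = (\<lambda>i. if deg i = deg g then w i else 0)"
    define w1 where "w1 = (\<lambda>i. if deg i = deg g then 0 else w i)"
    have deg: "deg i \<in> {0, 1}" for i by (cases i) auto
    have other: "deg i = 1 - deg g" if "deg i \<noteq> deg g" for i
      using deg[of i] deg[of g] that by auto
    have w: "w \<in> ?V" "f w = basis_vec g"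
      unfolding w_def using h basis_vec_gr_space[OF g] by auto
    have w0: "w0 \<in> homog n m (deg g)" and w1: "w1 \<in> homog n m (1 - deg g)"
      using w(1) other unfolding w0_def w1_def homog_def gr_space_def by auto
    have fw: "f w0 \<in> homog n m (deg g)" "f w1 \<in> homog n m (1 - deg g)"
      using f w0 w1 deg[of g] unfolding graded_GL_def by (auto simp: image_subset_iff)
    have "w = w0 + w1" unfolding w0_def w1_def by auto
    then have sum: "basis_vec g = f w0 + f w1"
      using w lin w0 w1 homog_subset unfolding linear_on_gr_def by (metis subsetD)
    \<comment> \<open>\<open>f w1\<close> has the degree opposite to that of \<open>g\<close>, while
      \<open>basis_vec g\<close> has no component in that degree; so \<open>f w1\<close> must vanish
      and \<open>w0\<close> is already the whole preimage.\<close>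
    have "f w1 i = 0" for i
    proof (cases "deg i = deg g")
      case True
      then show ?thesis using fw(2) deg[of g] unfolding homog_def by force
    next
      case False
      then have "f w0 i = 0" "basis_vec g i = (0::'a)"
        using fw(1) unfolding homog_def basis_vec_def by auto
      then show ?thesis using fun_cong[OF sum, of i] by simp
    qed
    then have "f w0 = f w" using sum w(2) by (auto simp: fun_eq_iff)
    then have "w = w0" using inj[of w0 w] w(1) w0 homog_subset by auto
    then show "?h (basis_vec g) \<in> homog n m (deg g)" using w0 unfolding w_def by simp
  qed
qed

section \<open>Isomorphisms of laws and orbits\<close>

definition law_iso ::
    "nat \<Rightarrow> nat \<Rightarrow> ((gen \<Rightarrow> 'a::field) \<Rightarrow> gen \<Rightarrow> 'a) \<Rightarrow> (gen \<times> gen \<times> gen \<Rightarrow> 'a) \<Rightarrow>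
     (gen \<times> gen \<times> gen \<Rightarrow> 'a) \<Rightarrow> bool" where
  "law_iso n m f \<mu> \<nu> \<longleftrightarrow> f \<in> graded_GL n m \<and>
     (\<forall>u\<in>gr_space n m. \<forall>v\<in>gr_space n m.
        f (bracket n m \<mu> u v) = bracket n m \<nu> (f u) (f v))"

text \<open>Bilinearity is used one argument at a time: first on the left with a basis vector on the
  right, then on the right.\<close>

lemma law_isoI_basis:
  assumes f: "f \<in> graded_GL n m"
    and \<mu>: "\<mu> \<in> affine_space (coords n m)" and \<nu>: "\<nu> \<in> affine_space (coords n m)"
    and eq: "\<And>i j. i \<in> gens n m \<Longrightarrow> j \<in> gens n m \<Longrightarrow>
      f (bracket n m \<mu> (basis_vec i) (basis_vec j)) = bracket n m \<nu> (f (basis_vec i)) (f (basis_vec j))"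
  shows "law_iso n m f \<mu> \<nu>"
  unfolding law_iso_def
proof (intro conjI f ballI)
  note lin = graded_GL_linear[OF f]
  fix u v :: "gen \<Rightarrow> 'a" assume u: "u \<in> gr_space n m" and v: "v \<in> gr_space n m"
  have "f (bracket n m \<mu> u (basis_vec j)) = bracket n m \<nu> (f u) (f (basis_vec j))"
    if j: "j \<in> gens n m" for j
    by (rule linear_on_gr_eqI[OF linear_on_gr_comp[OF lin bracket_linear_left[OF \<mu>]]
          linear_on_gr_comp[OF bracket_linear_left[OF \<nu>] lin] eq u]) (use j in auto)
  then show "f (bracket n m \<mu> u v) = bracket n m \<nu> (f u) (f v)"
    by (rule linear_on_gr_eqI[OF linear_on_gr_comp[OF lin bracket_linear_right[OF \<mu>]]
          linear_on_gr_comp[OF bracket_linear_right[OF \<nu>] lin] _ v])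
qed

lemma law_iso_inv_into:
  assumes "law_iso n m f \<mu> \<nu>" and \<mu>: "\<mu> \<in> affine_space (coords n m)"
  shows "law_iso n m (inv_into (gr_space n m) f) \<nu> \<mu>"
  unfolding law_iso_def
proof (intro conjI ballI)
  let ?V = "gr_space n m" and ?h = "inv_into (gr_space n m) f"
  have f: "f \<in> graded_GL n m" using assms unfolding law_iso_def by simp
  then show "?h \<in> graded_GL n m" by (rule graded_GL_inv_into)
  have bij: "bij_betw f ?V ?V" using f unfolding graded_GL_def by simp
  fix u v :: "gen \<Rightarrow> 'a" assume uv: "u \<in> ?V" "v \<in> ?V"
  then have h: "?h u \<in> ?V" "?h v \<in> ?V" "f (?h u) = u" "f (?h v) = v"
    using bij by (auto simp: bij_betw_def inv_into_into f_inv_into_f)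
  then have "f (bracket n m \<mu> (?h u) (?h v)) = bracket n m \<nu> u v"
    using assms unfolding law_iso_def by simp
  then show "?h (bracket n m \<nu> u v) = bracket n m \<mu> (?h u) (?h v)"
    using bij bracket_gr_space[OF \<mu>] by (metis bij_betw_inv_into_left)
qed

lemma act_affine_space: "act n m f \<nu> \<in> affine_space (coords n m)"
  unfolding act_def structure_constants_def affine_space_def by auto

text \<open>The action pulls laws back, so \<open>f\<close> is an isomorphism from the transformed
  law to \<open>\<nu>\<close>: applying \<open>f\<close> to the defining formula removes the
  inverse.\<close>

lemma eq_act_iff_law_iso:
  assumes f: "f \<in> graded_GL n m" and \<nu>: "\<nu> \<in> affine_space (coords n m)"
    and \<mu>: "\<mu> \<in> affine_space (coords n m)"
  shows "\<mu> = act n m f \<nu> \<longleftrightarrow> law_iso n m f \<mu> \<nu>"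
proof -
  let ?V = "gr_space n m" and ?h = "inv_into (gr_space n m) f"
  have bij: "bij_betw f ?V ?V" using f unfolding graded_GL_def by simp
  have hV: "?h v \<in> ?V" "f (?h v) = v" if "v \<in> ?V" for v
    using that bij by (auto simp: bij_betw_def inv_into_into f_inv_into_f)
  show ?thesis
  proof
    assume *: "\<mu> = act n m f \<nu>"
    show "law_iso n m f \<mu> \<nu>"
    proof (rule law_isoI_basis[OF f \<mu> \<nu>])
      fix i j assume ij: "i \<in> gens n m" "j \<in> gens n m"
      let ?b = "bracket n m \<nu> (f (basis_vec i)) (f (basis_vec j))"
      have b: "?b \<in> ?V" using \<nu> by (rule bracket_gr_space)
      have "bracket n m \<mu> (basis_vec i) (basis_vec j) = ?h ?b"
      proof
        fix k
        show "bracket n m \<mu> (basis_vec i) (basis_vec j) k = ?h ?b k"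
          using hV(1)[OF b] ij unfolding bracket_basis[OF ij] *
          by (auto simp: act_def structure_constants_def coords_def gr_space_def)
      qed
      then show "f (bracket n m \<mu> (basis_vec i) (basis_vec j)) = ?b"
        using hV(2)[OF b] by simp
    qed
  next
    assume *: "law_iso n m f \<mu> \<nu>"
    show "\<mu> = act n m f \<nu>"
    proof
      fix x :: "gen \<times> gen \<times> gen"
      obtain i j k where x: "x = (i, j, k)" by (cases x)
      show "\<mu> x = act n m f \<nu> x"
      proof (cases "x \<in> coords n m")
        case False
        then show ?thesis
          using \<mu> act_affine_space[of n m f \<nu>] unfolding affine_space_def
          by (metis (mono_tags, lifting) mem_Collect_eq)
      next
        case True
        then have ij: "i \<in> gens n m" "j \<in> gens n m" unfolding x coords_def by auto
        have "?h (bracket n m \<nu> (f (basis_vec i)) (f (basis_vec j))) =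
            ?h (f (bracket n m \<mu> (basis_vec i) (basis_vec j)))"
          using * ij unfolding law_iso_def by (simp add: basis_vec_gr_space)
        also have "\<dots> = bracket n m \<mu> (basis_vec i) (basis_vec j)"
          using bij bracket_gr_space[OF \<mu>] by (rule bij_betw_inv_into_left)
        finally show ?thesis
          using True ij unfolding x by (simp add: act_def structure_constants_def bracket_basis)
      qed
    qed
  qed
qed

lemma Orb_iff_law_iso:
  assumes "\<nu> \<in> affine_space (coords n m)"
  shows "\<mu> \<in> Orb n m \<nu> \<longleftrightarrow> \<mu> \<in> affine_space (coords n m) \<and> (\<exists>f. law_iso n m f \<mu> \<nu>)"
proof
  assume "\<mu> \<in> Orb n m \<nu>"
  then obtain f where f: "f \<in> graded_GL n m" "\<mu> = act n m f \<nu>" unfolding Orb_def by blast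
  then show "\<mu> \<in> affine_space (coords n m) \<and> (\<exists>f. law_iso n m f \<mu> \<nu>)"
    using eq_act_iff_law_iso[OF f(1) assms, of \<mu>] act_affine_space[of n m f \<nu>] by auto
next
  assume "\<mu> \<in> affine_space (coords n m) \<and> (\<exists>f. law_iso n m f \<mu> \<nu>)"
  then obtain f where "\<mu> \<in> affine_space (coords n m)" "law_iso n m f \<mu> \<nu>" by blast
  moreover from this have "f \<in> graded_GL n m" unfolding law_iso_def by simp
  ultimately show "\<mu> \<in> Orb n m \<nu>"
    using eq_act_iff_law_iso[OF _ assms] unfolding Orb_def by blast
qed

section \<open>The variety of Leibniz laws\<close>

lemma Leib_affine: "\<mu> \<in> Leib n m \<Longrightarrow> \<mu> \<in> affine_space (coords n m)"
  unfolding Leib_def by simp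

lemma Leib_grading:
  assumes "\<mu> \<in> Leib n m" "u \<in> homog n m a" "v \<in> homog n m b" "a \<in> {0, 1}" "b \<in> {0, 1}"
  shows "bracket n m \<mu> u v \<in> homog n m ((a + b) mod 2)"
  using assms unfolding Leib_def by blast

lemma Leib_identity:
  assumes "\<mu> \<in> Leib n m" "x \<in> gr_space n m" "y \<in> homog n m a" "z \<in> homog n m b"
    "a \<in> {0, 1}" "b \<in> {0, 1}"
  shows "bracket n m \<mu> x (bracket n m \<mu> y z) = bracket n m \<mu> (bracket n m \<mu> x y) z
            - smul ((- 1) ^ (a * b)) (bracket n m \<mu> (bracket n m \<mu> x z) y)"
  using assms unfolding Leib_def by blast

text \<open>Transport of structure: both conditions hold for \<open>\<nu>\<close> on the images
  under \<open>f\<close>. The grading is pulled back because the inverse of \<open>f\<close>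
  preserves degrees, the identity because \<open>f\<close> is injective.\<close>

lemma Leib_law_iso:
  assumes iso: "law_iso n m f \<mu> \<nu>" and \<nu>: "\<nu> \<in> Leib n m"
    and \<mu>: "\<mu> \<in> affine_space (coords n m)"
  shows "\<mu> \<in> Leib n m"
proof -
  let ?V = "gr_space n m" and ?h = "inv_into (gr_space n m) f"
  have f: "f \<in> graded_GL n m" and fb: "\<And>u v. u \<in> ?V \<Longrightarrow> v \<in> ?V \<Longrightarrow>
      f (bracket n m \<mu> u v) = bracket n m \<nu> (f u) (f v)"
    using iso unfolding law_iso_def by auto
  have bij: "bij_betw f ?V ?V" using f unfolding graded_GL_def by simp
  have fh: "f u \<in> homog n m a" if "u \<in> homog n m a" "a \<in> {0, 1}" for u a
    using f that unfolding graded_GL_def by blast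
  have hh: "?h u \<in> homog n m a" if "u \<in> homog n m a" "a \<in> {0, 1}" for u a
    using graded_GL_inv_into[OF f] that unfolding graded_GL_def by blast
  have hf: "?h (f u) = u" if "u \<in> ?V" for u
    using bij that by (rule bij_betw_inv_into_left)
  have fV: "f u \<in> ?V" if "u \<in> ?V" for u
    using bij that by (rule bij_betw_apply)
  have lin: "linear_on_gr n m f" using f by (rule graded_GL_linear)
  note bV = bracket_gr_space[OF \<mu>]
  have inj: "u = v" if "f u = f v" "u \<in> ?V" "v \<in> ?V" for u v
    using that bij unfolding bij_betw_def inj_on_def by blast
  show ?thesis
    unfolding Leib_def
  proof (intro CollectI conjI \<mu> ballI)
    fix a b :: nat and u v :: "gen \<Rightarrow> 'a"
    assume ab: "a \<in> {0, 1}" "b \<in> {0, 1}" and u: "u \<in> homog n m a" and v: "v \<in> homog n m b"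
    have uv: "u \<in> ?V" "v \<in> ?V" using u v homog_subset by auto
    have "bracket n m \<nu> (f u) (f v) \<in> homog n m ((a + b) mod 2)"
      using Leib_grading[OF \<nu> fh[OF u] fh[OF v]] ab by blast
    then have "?h (f (bracket n m \<mu> u v)) \<in> homog n m ((a + b) mod 2)"
      unfolding fb[OF uv] by (rule hh) auto
    then show "bracket n m \<mu> u v \<in> homog n m ((a + b) mod 2)"
      by (simp add: hf bV)
  next
    fix a b :: nat and x y z :: "gen \<Rightarrow> 'a"
    assume ab: "a \<in> {0, 1}" "b \<in> {0, 1}" and x: "x \<in> ?V"
      and y: "y \<in> homog n m a" and z: "z \<in> homog n m b"
    have yz: "y \<in> ?V" "z \<in> ?V" using y z homog_subset by auto
    let ?s = "(- 1) ^ (a * b) :: 'a"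
    let ?r = "bracket n m \<mu> (bracket n m \<mu> x y) z
            - smul ?s (bracket n m \<mu> (bracket n m \<mu> x z) y)"
    have r: "?r = bracket n m \<mu> (bracket n m \<mu> x y) z
            + smul (- ?s) (bracket n m \<mu> (bracket n m \<mu> x z) y)"
      by (auto simp: smul_def)
    have "f ?r = f (bracket n m \<mu> (bracket n m \<mu> x y) z)
            + smul (- ?s) (f (bracket n m \<mu> (bracket n m \<mu> x z) y))"
      unfolding r using lin bV gr_space_smul[OF bV] unfolding linear_on_gr_def by simp
    also have "\<dots> = bracket n m \<nu> (bracket n m \<nu> (f x) (f y)) (f z)
            - smul ?s (bracket n m \<nu> (bracket n m \<nu> (f x) (f z)) (f y))"
      using x yz by (auto simp: fb bV smul_def)
    also have "\<dots> = bracket n m \<nu> (f x) (bracket n m \<nu> (f y) (f z))"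
      using Leib_identity[OF \<nu> fV[OF x] fh[OF y] fh[OF z]] ab by simp
    also have "\<dots> = f (bracket n m \<mu> x (bracket n m \<mu> y z))"
      using x yz by (simp add: fb bV)
    finally have "f (bracket n m \<mu> x (bracket n m \<mu> y z)) = f ?r" by (rule sym)
    moreover have "?r \<in> ?V"
      unfolding r by (intro gr_space_add gr_space_smul bV)
    ultimately show "bracket n m \<mu> x (bracket n m \<mu> y z) = ?r"
      by (rule inj[OF _ bV])
  qed
qed

text \<open>For fixed vectors and a fixed coordinate, each defining condition is one polynomial
  equation in the structure constants; \<open>G\<close> collects all of them.\<close>

lemma closedin_Leib: "closedin (zariski (coords n m)) (Leib n m :: (_ \<Rightarrow> 'a::field) set)"
proof -
  let ?I = "coords n m" and ?V = "gr_space n m"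
  define G :: "((gen \<times> gen \<times> gen \<Rightarrow> 'a) \<Rightarrow> 'a) set" where
    "G = {\<lambda>\<mu>. bracket n m \<mu> u v k | a b u v k. a \<in> {0, 1} \<and> b \<in> {0, 1} \<and>
            u \<in> homog n m a \<and> v \<in> homog n m b \<and> k \<in> gens n m \<and> deg k \<noteq> (a + b) mod 2} \<union>
         {\<lambda>\<mu>. bracket n m \<mu> x (bracket n m \<mu> y z) k - (bracket n m \<mu> (bracket n m \<mu> x y) z
            - smul ((- 1) ^ (a * b)) (bracket n m \<mu> (bracket n m \<mu> x z) y)) k | a b x y z k.
            a \<in> {0, 1} \<and> b \<in> {0, 1} \<and> x \<in> ?V \<and> y \<in> homog n m a \<and> z \<in> homog n m b \<and> k \<in> gens n m}"
  \<comment> \<open>The arguments \<open>p\<close> and \<open>q\<close> may themselves depend on the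
    law, which covers the nested brackets of the Leibniz identity.\<close>
  have br: "(\<lambda>\<mu>. bracket n m \<mu> (p \<mu>) (q \<mu>) k) \<in> polynomial_functions ?I"
    if "\<And>i. i \<in> gens n m \<Longrightarrow> (\<lambda>\<mu>. p \<mu> i) \<in> polynomial_functions ?I"
      "\<And>i. i \<in> gens n m \<Longrightarrow> (\<lambda>\<mu>. q \<mu> i) \<in> polynomial_functions ?I"
      "k \<in> gens n m" for p q k
    unfolding bracket_def using that
    by (intro polyfun.sum polyfun.mult polynomial_functions_coord) (auto simp: coords_def)
  have br': "(\<lambda>\<mu>. bracket n m \<mu> x y k) \<in> polynomial_functions ?I"
    if "k \<in> gens n m" for x y :: "gen \<Rightarrow> 'a" and k
    by (intro br polyfun.const that)
  have "G \<subseteq> polynomial_functions ?I"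
    unfolding G_def
  proof (intro Un_least subsetI; elim CollectE exE conjE; simp only: fun_diff_def smul_def)
    show "(\<lambda>\<mu>. bracket n m \<mu> u v k) \<in> polynomial_functions ?I" if "k \<in> gens n m"
      for u v :: "gen \<Rightarrow> 'a" and k
      using that by (rule br')
    show "(\<lambda>\<mu>. bracket n m \<mu> x (bracket n m \<mu> y z) k - (bracket n m \<mu> (bracket n m \<mu> x y) z k
            - s * bracket n m \<mu> (bracket n m \<mu> x z) y k)) \<in> polynomial_functions ?I"
      if "k \<in> gens n m" for x y z :: "gen \<Rightarrow> 'a" and s k
      using that by (intro polyfun.diff polyfun.mult polyfun.const br)
  qed
  then have "closedin (zariski ?I) {\<mu> \<in> affine_space ?I. \<forall>g\<in>G. g \<mu> = 0}"
    by (rule closedin_zariski_polynomial_functions)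
  also have "{\<mu> \<in> affine_space ?I. \<forall>g\<in>G. g \<mu> = 0} = Leib n m" (is "?Z = _")
  proof (intro equalityI subsetI)
    fix \<mu> :: "gen \<times> gen \<times> gen \<Rightarrow> 'a" assume \<mu>: "\<mu> \<in> Leib n m"
    have "g \<mu> = 0" if "g \<in> G" for g
      using that unfolding G_def
    proof (elim UnE CollectE exE conjE)
      fix a b :: nat and u v :: "gen \<Rightarrow> 'a" and k
      assume "g = (\<lambda>\<mu>. bracket n m \<mu> u v k)" "a \<in> {0, 1}" "b \<in> {0, 1}"
        "u \<in> homog n m a" "v \<in> homog n m b" "deg k \<noteq> (a + b) mod 2"
      then show ?thesis using Leib_grading[OF \<mu>, of u a v b] unfolding homog_def by auto
    next
      fix a b :: nat and x y z :: "gen \<Rightarrow> 'a" and k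
      assume g: "g = (\<lambda>\<mu>. bracket n m \<mu> x (bracket n m \<mu> y z) k - (bracket n m \<mu> (bracket n m \<mu> x y) z
            - smul ((- 1) ^ (a * b)) (bracket n m \<mu> (bracket n m \<mu> x z) y)) k)"
        and "a \<in> {0, 1}" "b \<in> {0, 1}" "x \<in> ?V" "y \<in> homog n m a" "z \<in> homog n m b"
      then show ?thesis using Leib_identity[OF \<mu>, of x y a z b] by simp
    qed
    then show "\<mu> \<in> ?Z" using Leib_affine[OF \<mu>] by simp
  next
    fix \<mu> :: "gen \<times> gen \<times> gen \<Rightarrow> 'a" assume "\<mu> \<in> ?Z"
    then have \<mu>: "\<mu> \<in> affine_space ?I" and Z: "\<And>g. g \<in> G \<Longrightarrow> g \<mu> = 0" by auto
    show "\<mu> \<in> Leib n m"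
      unfolding Leib_def
    proof (intro CollectI conjI \<mu> ballI)
      fix a b :: nat and u v :: "gen \<Rightarrow> 'a"
      assume ab: "a \<in> {0, 1}" "b \<in> {0, 1}" and uv: "u \<in> homog n m a" "v \<in> homog n m b"
      have "bracket n m \<mu> u v k = 0" if "k \<in> gens n m" "deg k \<noteq> (a + b) mod 2" for k
      proof -
        have "(\<lambda>\<mu>. bracket n m \<mu> u v k) \<in> G"
          unfolding G_def using ab uv that by blast
        then show ?thesis using Z by blast
      qed
      then show "bracket n m \<mu> u v \<in> homog n m ((a + b) mod 2)"
        using bracket_gr_space[OF \<mu>, of u v] unfolding homog_def gr_space_def by blast
    next
      fix a b :: nat and x y z :: "gen \<Rightarrow> 'a"
      assume ab: "a \<in> {0, 1}" "b \<in> {0, 1}" and xyz: "x \<in> ?V" "y \<in> homog n m a" "z \<in> homog n m b"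
      show "bracket n m \<mu> x (bracket n m \<mu> y z) = bracket n m \<mu> (bracket n m \<mu> x y) z
            - smul ((- 1) ^ (a * b)) (bracket n m \<mu> (bracket n m \<mu> x z) y)" (is "?l = ?r")
      proof
        fix k
        show "?l k = ?r k"
        proof (cases "k \<in> gens n m")
          case True
          have "(\<lambda>\<mu>. bracket n m \<mu> x (bracket n m \<mu> y z) k - (bracket n m \<mu> (bracket n m \<mu> x y) z
              - smul ((- 1) ^ (a * b)) (bracket n m \<mu> (bracket n m \<mu> x z) y)) k) \<in> G"
            unfolding G_def using ab xyz True by blast
          then show ?thesis using Z by fastforce
        next
          case False
          then show ?thesis using bracket_gr_space[OF \<mu>] unfolding gr_space_def smul_def by simp
        qed
      qed
    qed
  qed
  finally show ?thesis .
qed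

section \<open>Coordinates along a cyclic basis\<close>

text \<open>The order \<open>Y 1, X 1, Y 2, X 2, \<dots>\<close> in which the basis is generated from \<open>Y 1\<close>.\<close>

definition enum_gen :: "nat \<Rightarrow> gen" where
  "enum_gen j = (if even j then Y (Suc (j div 2)) else X (Suc (j div 2)))"

lemma enum_gen_eq_iff [simp]: "enum_gen i = enum_gen j \<longleftrightarrow> i = j"
  unfolding enum_gen_def by (auto; presburger)

lemma deg_enum_gen: "deg (enum_gen j) = Suc j mod 2"
  unfolding enum_gen_def by (auto simp: mod2_eq_if)

lemma enum_gen_01: "enum_gen 0 = Y 1" "enum_gen 1 = X 1" "enum_gen (Suc 0) = X 1"
  unfolding enum_gen_def by auto

lemma enum_gen_Suc: "enum_gen (Suc j) \<noteq> Y 1" "enum_gen (Suc j) = X 1 \<longleftrightarrow> j = 0"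
  using enum_gen_eq_iff[of "Suc j" 0] enum_gen_eq_iff[of "Suc j" 1] by (simp_all add: enum_gen_01)

text \<open>The base change that sends the \<open>j\<close>-th vector of the enumerated basis to
  \<open>v j\<close>; its matrix is \<open>gen_mat N v\<close>.\<close>

definition comb :: "nat \<Rightarrow> (nat \<Rightarrow> gen \<Rightarrow> 'a::field) \<Rightarrow> (gen \<Rightarrow> 'a) \<Rightarrow> gen \<Rightarrow> 'a" where
  "comb N v u = (\<lambda>k. \<Sum>j<N. u (enum_gen j) * v j k)"

definition gen_mat :: "nat \<Rightarrow> (nat \<Rightarrow> gen \<Rightarrow> 'a::field) \<Rightarrow> 'a mat" where
  "gen_mat N v = mat N N (\<lambda>(k, j). v j (enum_gen k))"

text \<open>The linear map given by the adjugate of the matrix of \<open>comb N v\<close>. It is the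
  inverse up to the determinant and, unlike the inverse, depends polynomially on
  \<open>v\<close>.\<close>

definition gen_adj :: "nat \<Rightarrow> (nat \<Rightarrow> gen \<Rightarrow> 'a::field) \<Rightarrow> (gen \<Rightarrow> 'a) \<Rightarrow> gen \<Rightarrow> 'a" where
  "gen_adj N v w = (\<lambda>g. \<Sum>i<N. (\<Sum>k<N. adj_mat (gen_mat N v) $$ (i, k) * w (enum_gen k)) *
     basis_vec (enum_gen i) g)"

lemma gen_mat_carrier: "gen_mat N v \<in> carrier_mat N N"
  unfolding gen_mat_def by simp

lemma gen_mat_index: "k < N \<Longrightarrow> j < N \<Longrightarrow> gen_mat N v $$ (k, j) = v j (enum_gen k)"
  unfolding gen_mat_def by simp

lemma index_mult_mat_sum:
  assumes "A \<in> carrier_mat N N" "B \<in> carrier_mat N N" "i < N" "j < N"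
  shows "(A * B) $$ (i, j) = (\<Sum>k<N. A $$ (i, k) * B $$ (k, j))"
  using assms by (simp add: scalar_prod_def atLeast0LessThan)

text \<open>For these dimensions the first \<open>n + m\<close> terms of the enumeration
  \<open>Y 1, X 1, Y 2, X 2, \<dots>\<close> are exactly the basis. Both families are handled at
  once.\<close>

locale interleaved =
  fixes n m :: nat
  assumes n_ge_1: "1 \<le> n" and m_cases: "m = n \<or> m = n + 1"
begin

abbreviation "N \<equiv> n + m"
abbreviation "V \<equiv> gr_space n m"

lemma N_ge_2: "2 \<le> N"
  using n_ge_1 m_cases by auto

lemma gens_enum: "gens n m = enum_gen ` {..<N}"
proof (intro equalityI subsetI)
  fix g assume g: "g \<in> gens n m"
  show "g \<in> enum_gen ` {..<N}"
  proof (cases g)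
    case (X i)
    then show ?thesis
      using g m_cases by (intro image_eqI[of _ _ "2 * i - 1"]) (auto simp: gens_def enum_gen_def)
  next
    case (Y i)
    then show ?thesis
      using g m_cases by (intro image_eqI[of _ _ "2 * i - 2"]) (auto simp: gens_def enum_gen_def)
  qed
next
  fix g assume "g \<in> enum_gen ` {..<N}"
  then show "g \<in> gens n m"
    using m_cases by (auto simp: gens_def enum_gen_def elim!: evenE oddE)
qed

lemma enum_gen_in_gens: "j < N \<Longrightarrow> enum_gen j \<in> gens n m"
  unfolding gens_enum by simp

lemma sum_gens: "(\<Sum>g\<in>gens n m. h g) = (\<Sum>j<N. h (enum_gen j))"
  unfolding gens_enum by (subst sum.reindex) (auto simp: inj_on_def)

lemma gr_space_eqI:
  assumes "u \<in> V" "v \<in> V" "\<And>j. j < N \<Longrightarrow> u (enum_gen j) = v (enum_gen j)"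
  shows "u = v"
proof
  fix g show "u g = v g"
    using assms unfolding gr_space_def gens_enum by (cases "g \<in> enum_gen ` {..<N}") auto
qed

lemma comb_gr_space: "(\<And>j. j < N \<Longrightarrow> v j \<in> V) \<Longrightarrow> comb N v u \<in> V"
  unfolding comb_def by (rule gr_space_sum) simp

lemma comb_basis: "j < N \<Longrightarrow> comb N v (basis_vec (enum_gen j)) = v j"
  unfolding comb_def basis_vec_def by (simp add: if_distrib[of "\<lambda>x. x * _"] cong: if_cong)

lemma comb_linear:
  assumes "\<And>j. j < N \<Longrightarrow> v j \<in> V"
  shows "linear_on_gr n m (comb N v)"
proof (rule linear_on_grI)
  show "comb N v u = (\<lambda>k. \<Sum>g\<in>gens n m. u g * comb N v (basis_vec g) k)" for u
    unfolding sum_gens by (auto simp: comb_basis comb_def[of N v u])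
  show "comb N v (basis_vec g) \<in> V" for g
    using assms by (rule comb_gr_space)
qed

lemma gen_adj_gr_space: "gen_adj N v w \<in> V"
  unfolding gen_adj_def by (rule gr_space_sum) (simp add: basis_vec_gr_space enum_gen_in_gens)

lemma gen_adj_index:
  assumes "i < N"
  shows "gen_adj N v w (enum_gen i) = (\<Sum>k<N. adj_mat (gen_mat N v) $$ (i, k) * w (enum_gen k))"
  using assms unfolding gen_adj_def basis_vec_def
  by (simp add: if_distrib[of "\<lambda>x. _ * x"] cong: if_cong)

lemma comb_gen_adj:
  assumes v: "\<And>j. j < N \<Longrightarrow> v j \<in> V" and w: "w \<in> V"
  shows "comb N v (gen_adj N v w) = smul (det (gen_mat N v)) w"
proof (rule gr_space_eqI[OF comb_gr_space[OF v] gr_space_smul[OF w]])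
  fix l assume l: "l < N"
  let ?A = "gen_mat N v"
  note A = gen_mat_carrier[of N v]
  have "comb N v (gen_adj N v w) (enum_gen l) =
      (\<Sum>j<N. \<Sum>k<N. ?A $$ (l, j) * adj_mat ?A $$ (j, k) * w (enum_gen k))"
    unfolding comb_def using l
    by (intro sum.cong) (auto simp: gen_adj_index gen_mat_index sum_distrib_left mult_ac)
  also have "\<dots> = (\<Sum>k<N. (?A * adj_mat ?A) $$ (l, k) * w (enum_gen k))"
    using l adj_mat(1)[OF A] A
    by (subst sum.swap) (auto simp: index_mult_mat_sum sum_distrib_right intro!: sum.cong simp del: index_mult_mat)
  also have "\<dots> = (\<Sum>k<N. if k = l then det ?A * w (enum_gen k) else 0)"
    using l unfolding adj_mat(2)[OF A] by (intro sum.cong) auto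
  finally show "comb N v (gen_adj N v w) (enum_gen l) = smul (det ?A) w (enum_gen l)"
    using l by (simp add: smul_def)
qed simp

lemma gen_adj_comb:
  assumes u: "u \<in> V"
  shows "gen_adj N v (comb N v u) = smul (det (gen_mat N v)) u"
proof (rule gr_space_eqI[OF gen_adj_gr_space gr_space_smul[OF u]])
  fix l assume l: "l < N"
  let ?A = "gen_mat N v"
  note A = gen_mat_carrier[of N v]
  have "gen_adj N v (comb N v u) (enum_gen l) =
      (\<Sum>k<N. \<Sum>j<N. adj_mat ?A $$ (l, k) * ?A $$ (k, j) * u (enum_gen j))"
    using l unfolding gen_adj_index[OF l] comb_def
    by (intro sum.cong) (auto simp: gen_mat_index sum_distrib_left mult_ac)
  also have "\<dots> = (\<Sum>j<N. (adj_mat ?A * ?A) $$ (l, j) * u (enum_gen j))"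
    using l adj_mat(1)[OF A] A
    by (subst sum.swap) (auto simp: index_mult_mat_sum sum_distrib_right intro!: sum.cong simp del: index_mult_mat)
  also have "\<dots> = (\<Sum>j<N. if j = l then det ?A * u (enum_gen j) else 0)"
    using l unfolding adj_mat(3)[OF A] by (intro sum.cong) auto
  finally show "gen_adj N v (comb N v u) (enum_gen l) = smul (det ?A) u (enum_gen l)"
    using l by (simp add: smul_def)
qed

text \<open>Dividing \<open>gen_adj\<close> by the determinant gives a two-sided inverse of
  \<open>comb\<close>. The explicit formula shows that the determinant is the only
  denominator.\<close>

lemma
  assumes v: "\<And>j. j < N \<Longrightarrow> v j \<in> V" and d: "det (gen_mat N v) \<noteq> 0"
  shows comb_bij: "bij_betw (comb N v) V V"
    and comb_inv_into: "w \<in> V \<Longrightarrow>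
      inv_into V (comb N v) w = smul (1 / det (gen_mat N v)) (gen_adj N v w)"
proof -
  let ?d = "det (gen_mat N v)" and ?h = "\<lambda>w. smul (1 / det (gen_mat N v)) (gen_adj N v w)"
  have smul: "smul (1 / ?d) (smul ?d u) = u" for u
    using d by (simp add: smul_def)
  have fh: "comb N v (?h w) = w" if "w \<in> V" for w
    using comb_linear[of v] v gen_adj_gr_space[of v w] comb_gen_adj[of v w] that smul
    unfolding linear_on_gr_def by metis
  have hf: "?h (comb N v u) = u" if "u \<in> V" for u
    unfolding gen_adj_comb[OF that] by (rule smul)
  show bij: "bij_betw (comb N v) V V"
  proof (rule bij_betw_byWitness[of _ ?h])
    show "comb N v ` V \<subseteq> V" using comb_gr_space[OF v] by auto
    show "?h ` V \<subseteq> V" using gr_space_smul[OF gen_adj_gr_space] by auto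
  qed (use fh hf in auto)
  show "inv_into V (comb N v) w = ?h w" if w: "w \<in> V"
    using bij_betw_inv_into_left[OF bij gr_space_smul[OF gen_adj_gr_space[of v w], of "1 / ?d"]]
    unfolding fh[OF w] .
qed

text \<open>The matrices of \<open>f\<close> and of its inverse multiply to the identity, so their
  determinants multiply to 1.\<close>

lemma det_gen_mat_ne_0:
  assumes f: "f \<in> graded_GL n m"
  shows "det (gen_mat N (\<lambda>j. f (basis_vec (enum_gen j)))) \<noteq> 0"
proof -
  let ?h = "inv_into V f"
  let ?A = "gen_mat N (\<lambda>j. f (basis_vec (enum_gen j)))"
  let ?B = "gen_mat N (\<lambda>j. ?h (basis_vec (enum_gen j)))"
  have bij: "bij_betw f V V" using f unfolding graded_GL_def by simp
  have "?A * ?B = 1\<^sub>m N"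
  proof (rule eq_matI)
    fix k j assume "k < dim_row (1\<^sub>m N :: 'a mat)" "j < dim_col (1\<^sub>m N :: 'a mat)"
    then have kj: "k < N" "j < N" by auto
    let ?e = "basis_vec (enum_gen j) :: gen \<Rightarrow> 'a"
    have e: "?e \<in> V" using kj by (simp add: basis_vec_gr_space enum_gen_in_gens)
    have h: "?h ?e \<in> V" "f (?h ?e) = ?e"
      using e bij by (auto simp: bij_betw_def inv_into_into f_inv_into_f)
    have "(?A * ?B) $$ (k, j) = (\<Sum>l<N. ?A $$ (k, l) * ?B $$ (l, j))"
      using kj by (intro index_mult_mat_sum gen_mat_carrier)
    also have "\<dots> = (\<Sum>l<N. ?h ?e (enum_gen l) * f (basis_vec (enum_gen l)) (enum_gen k))"
      using kj by (intro sum.cong) (auto simp: gen_mat_index)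
    also have "\<dots> = f (?h ?e) (enum_gen k)"
      unfolding linear_on_gr_expansion[OF graded_GL_linear[OF f] h(1)] sum_gens ..
    also have "\<dots> = 1\<^sub>m N $$ (k, j)"
      using kj unfolding h(2) by (auto simp: basis_vec_def)
    finally show "(?A * ?B) $$ (k, j) = 1\<^sub>m N $$ (k, j)" .
  qed (simp_all add: gen_mat_def)
  then have "det ?A * det ?B = 1"
    using det_mult[OF gen_mat_carrier gen_mat_carrier] by (metis det_one)
  then show ?thesis by auto
qed

lemma comb_graded_GL:
  assumes v: "\<And>j. j < N \<Longrightarrow> v j \<in> homog n m (Suc j mod 2)" and d: "det (gen_mat N v) \<noteq> 0"
  shows "comb N v \<in> graded_GL n m"
proof (rule graded_GLI)
  have V: "v j \<in> V" if "j < N" for j using v[OF that] homog_subset by auto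
  show "linear_on_gr n m (comb N v)" using V by (rule comb_linear)
  show "bij_betw (comb N v) V V" using V d by (rule comb_bij)
  show "comb N v (basis_vec g) \<in> homog n m (deg g)" if "g \<in> gens n m" for g
    using that v unfolding gens_enum by (auto simp: comb_basis deg_enum_gen)
qed

end

section \<open>Laws generated by one odd element\<close>

text \<open>The images of the enumerated basis under right multiplication by \<open>Y 1\<close>:
  each vector goes to the next one, with the factor 1/2 on the way from an \<open>X\<close> to a
  \<open>Y\<close>, and the last one goes to \<open>z\<close>. So \<open>cyc_op\<close> is a
  companion matrix up to scaling.\<close>

definition cyc_image :: "nat \<Rightarrow> (gen \<Rightarrow> 'a::field) \<Rightarrow> nat \<Rightarrow> gen \<Rightarrow> 'a" where
  "cyc_image N z j =
     (if Suc j < N then smul (if even j then 1 else 1 / 2) (basis_vec (enum_gen (Suc j))) else z)"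

definition cyc_op :: "nat \<Rightarrow> (gen \<Rightarrow> 'a::field) \<Rightarrow> (gen \<Rightarrow> 'a) \<Rightarrow> gen \<Rightarrow> 'a" where
  "cyc_op N z = comb N (cyc_image N z)"

text \<open>
  Here \<open>Y 1\<close> acts on the right as \<open>R = cyc_op (n + m) z\<close>; since \<open>[Y 1, Y 1] = X 1\<close>, the Leibniz identity
  then forces \<open>X 1\<close> to act as \<open>2 R\<^sup>2\<close>.
\<close>

definition cyc_law :: "nat \<Rightarrow> nat \<Rightarrow> (gen \<Rightarrow> 'a::field) \<Rightarrow> gen \<times> gen \<times> gen \<Rightarrow> 'a" where
  "cyc_law n m z = structure_constants n m (\<lambda>i j k.
     if j = Y 1 then cyc_op (n + m) z (basis_vec i) k
     else if j = X 1 then 2 * cyc_op (n + m) z (cyc_op (n + m) z (basis_vec i)) k else 0)"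

text \<open>The vector \<open>z\<close> has the degree that the next term of the enumeration would
  have. Its coordinates at \<open>Y 1\<close> and \<open>X 1\<close>, the only ones that matter for
  right multiplication, vanish, so \<open>z\<close> acts on the right by zero.\<close>

definition cyc_params :: "nat \<Rightarrow> nat \<Rightarrow> (gen \<Rightarrow> 'a::field) set" where
  "cyc_params n m = {z \<in> homog n m (Suc (n + m) mod 2). z (Y 1) = 0 \<and> z (X 1) = 0}"

lemma cyc_law_affine: "cyc_law n m z \<in> affine_space (coords n m)"
  unfolding cyc_law_def structure_constants_def affine_space_def by auto

text \<open>The factors cancel those in \<open>cyc_image\<close>, so an isomorphism with a \<open>cyc_law\<close> carries the sequence
  to the basis itself, not just to multiples of it.\<close>

primrec cyc_seq ::
    "nat \<Rightarrow> nat \<Rightarrow> (gen \<times> gen \<times> gen \<Rightarrow> 'a::field) \<Rightarrow> (gen \<Rightarrow> 'a) \<Rightarrow> nat \<Rightarrow> gen \<Rightarrow> 'a" where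
  "cyc_seq n m \<mu> y 0 = y"
| "cyc_seq n m \<mu> y (Suc j) =
     smul (if even j then 1 else 2) (bracket n m \<mu> (cyc_seq n m \<mu> y j) y)"

context interleaved
begin

lemma Y1_gens: "Y 1 \<in> gens n m" and X1_gens: "X 1 \<in> gens n m"
  using n_ge_1 m_cases unfolding gens_def by auto

lemma cyc_image_gr_space: "z \<in> V \<Longrightarrow> cyc_image N z j \<in> V"
  unfolding cyc_image_def by (simp add: gr_space_smul basis_vec_gr_space enum_gen_in_gens)

lemma cyc_op_linear: "z \<in> V \<Longrightarrow> linear_on_gr n m (cyc_op N z)"
  unfolding cyc_op_def by (intro comb_linear cyc_image_gr_space)

lemma cyc_op_gr_space: "z \<in> V \<Longrightarrow> cyc_op N z u \<in> V"
  unfolding cyc_op_def by (intro comb_gr_space cyc_image_gr_space)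

lemma cyc_op_basis: "j < N \<Longrightarrow> cyc_op N z (basis_vec (enum_gen j)) = cyc_image N z j"
  unfolding cyc_op_def by (rule comb_basis)

lemma bracket_cyc_law:
  assumes z: "z \<in> V" and u: "u \<in> V" and w: "w \<in> V"
  shows "bracket n m (cyc_law n m z) u w =
    smul (w (Y 1)) (cyc_op N z u) + smul (2 * w (X 1)) (cyc_op N z (cyc_op N z u))"
proof (rule gr_space_eqI)
  show "bracket n m (cyc_law n m z) u w \<in> V"
    using cyc_law_affine by (rule bracket_gr_space)
  show "smul (w (Y 1)) (cyc_op N z u) + smul (2 * w (X 1)) (cyc_op N z (cyc_op N z u)) \<in> V"
    using z by (intro gr_space_add gr_space_smul cyc_op_gr_space)
  let ?R = "cyc_op N z" and ?b = "basis_vec :: gen \<Rightarrow> gen \<Rightarrow> 'a"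
  fix l assume "l < N"
  define k where "k = enum_gen l"
  have k: "k \<in> gens n m" unfolding k_def using \<open>l < N\<close> by (rule enum_gen_in_gens)
  have "bracket n m (cyc_law n m z) u w k = (\<Sum>i\<in>gens n m. \<Sum>j\<in>gens n m.
      (if j = Y 1 then w (Y 1) * (u i * ?R (?b i) k) else 0) +
      (if j = X 1 then 2 * w (X 1) * (u i * ?R (?R (?b i)) k) else 0))"
    unfolding bracket_def cyc_law_def structure_constants_def using k
    by (intro sum.cong) (auto simp: coords_def)
  also have "\<dots> = (\<Sum>i\<in>gens n m. w (Y 1) * (u i * ?R (?b i) k) + 2 * w (X 1) * (u i * ?R (?R (?b i)) k))"
    using Y1_gens X1_gens finite_gens by (simp add: sum.distrib)
  also have "\<dots> = w (Y 1) * ?R u k + 2 * w (X 1) * ?R (?R u) k"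
    using fun_cong[OF linear_on_gr_expansion[OF cyc_op_linear[OF z] u], of k]
      fun_cong[OF linear_on_gr_expansion[OF linear_on_gr_comp[OF cyc_op_linear[OF z] cyc_op_linear[OF z]] u], of k]
    by (simp add: sum.distrib sum_distrib_left)
  finally show "bracket n m (cyc_law n m z) u w (enum_gen l) =
      (smul (w (Y 1)) (?R u) + smul (2 * w (X 1)) (?R (?R u))) (enum_gen l)"
    unfolding k_def by (simp add: smul_def)
qed

text \<open>All right multiplications are polynomials in one operator \<open>R\<close>, so they
  commute. The Leibniz identity reduces to the coordinates of \<open>[y, w]\<close> at
  \<open>Y 1\<close> and \<open>X 1\<close>.\<close>

lemma cyc_law_Leib:
  assumes z: "z \<in> cyc_params n m"
  shows "cyc_law n m z \<in> Leib n m"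
proof -
  let ?R = "cyc_op N z" and ?b = "bracket n m (cyc_law n m z)"
  have zh: "z \<in> homog n m (Suc N mod 2)" and z01: "z (Y 1) = 0" "z (X 1) = 0"
    using z unfolding cyc_params_def by auto
  have zV: "z \<in> V" using zh homog_subset by auto
  note br = bracket_cyc_law[OF zV] and RV = cyc_op_gr_space[OF zV]
  have bV: "?b u w \<in> V" for u w using cyc_law_affine by (rule bracket_gr_space)
  \<comment> \<open>No basis vector is sent to one with a \<open>Y 1\<close> component, and only
    \<open>Y 1\<close> is sent to one with an \<open>X 1\<close> component; for the last basis
    vector this is the condition on \<open>z\<close>.\<close>
  have RY1: "?R u (Y 1) = 0" for u
    unfolding cyc_op_def comb_def cyc_image_def
    using z01 enum_gen_Suc(1) by (intro sum.neutral) (auto simp: smul_def basis_vec_def eq_commute[of "Y _"])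
  have RX1: "?R u (X 1) = u (Y 1)" for u
  proof -
    have "?R u (X 1) = (\<Sum>j<N. if j = 0 then u (Y 1) else 0)"
      unfolding cyc_op_def comb_def cyc_image_def
      using z01 N_ge_2 enum_gen_Suc(2)
      by (intro sum.cong) (auto simp: smul_def basis_vec_def eq_commute[of "X _"] enum_gen_01)
    then show ?thesis using n_ge_1 by simp
  qed
  have Rhom: "?R u \<in> homog n m (Suc a mod 2)" if u: "u \<in> homog n m a" for u a
    unfolding cyc_op_def comb_def
  proof (rule homog_sum)
    fix j assume "j \<in> {..<N}"
    then have j: "j < N" by simp
    show "u (enum_gen j) = 0 \<or> cyc_image N z j \<in> homog n m (Suc a mod 2)"
    proof (cases "u (enum_gen j) = 0")
      case False
      then have a: "a = Suc j mod 2" using u unfolding homog_def deg_enum_gen[symmetric] by auto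
      show ?thesis
      proof (cases "Suc j < N")
        case True
        then show ?thesis unfolding cyc_image_def a
          by (auto intro!: homog_smul basis_vec_homog enum_gen_in_gens simp: deg_enum_gen mod_Suc_eq)
      next
        case False
        then have "N = Suc j" using j by simp
        then show ?thesis using zh unfolding cyc_image_def a by (simp add: mod_Suc_eq)
      qed
    qed simp
  qed
  have bh: "?b u w \<in> homog n m ((a + b) mod 2)"
    if ab: "a \<in> {0, 1}" "b \<in> {0, 1}" and u: "u \<in> homog n m a" and w: "w \<in> homog n m b" for a b u w
  proof -
    have uw: "u \<in> V" "w \<in> V" using u w homog_subset by auto
    have R: "?R u \<in> homog n m (Suc a mod 2)" "?R (?R u) \<in> homog n m (Suc (Suc a mod 2) mod 2)"
      using Rhom[OF u] Rhom[OF Rhom[OF u]] by auto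
    show ?thesis
    proof (cases "b = 0")
      case True
      then have "w (Y 1) = 0" using w unfolding homog_def by fastforce
      then have "?b u w = smul (2 * w (X 1)) (?R (?R u))"
        unfolding br[OF uw] by (simp add: smul_def fun_eq_iff)
      then show ?thesis using R(2) ab True by (auto intro!: homog_smul)
    next
      case False
      then have "w (X 1) = 0" using w ab unfolding homog_def by fastforce
      then have "?b u w = smul (w (Y 1)) (?R u)"
        unfolding br[OF uw] by (simp add: smul_def fun_eq_iff)
      then show ?thesis using R(1) ab False by (auto intro!: homog_smul)
    qed
  qed
  show ?thesis
    unfolding Leib_def
  proof (intro CollectI conjI cyc_law_affine ballI)
    fix a b :: nat and x y w :: "gen \<Rightarrow> 'a"
    assume ab: "a \<in> {0, 1}" "b \<in> {0, 1}" and x: "x \<in> V"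
      and y: "y \<in> homog n m a" and w: "w \<in> homog n m b"
    have yw: "y \<in> V" "w \<in> V" using y w homog_subset by auto
    have Y: "?b y w (Y 1) = 0" and X: "?b y w (X 1) = w (Y 1) * y (Y 1)"
      unfolding br[OF yw] by (simp_all add: smul_def RY1[simplified] RX1[simplified])
    have R3: "?R (smul c (?R x) + smul d (?R (?R x))) = smul c (?R (?R x)) + smul d (?R (?R (?R x)))" for c d
      using cyc_op_linear[OF zV] RV gr_space_smul[OF RV] unfolding linear_on_gr_def by simp
    have R4: "?R (smul c (?R (?R x)) + smul d (?R (?R (?R x)))) =
        smul c (?R (?R (?R x))) + smul d (?R (?R (?R (?R x))))" for c d
      using cyc_op_linear[OF zV] RV gr_space_smul[OF RV] unfolding linear_on_gr_def by simp
    \<comment> \<open>Only the pair of odd arguments contributes: there the sign turns the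
      difference into a sum of two equal terms in \<open>R\<^sup>2\<close>. In the other parities
      both sides are zero.\<close>
    have parity: "(a = 0 \<longrightarrow> y (Y 1) = 0) \<and> (a = 1 \<longrightarrow> y (X 1) = 0) \<and>
        (b = 0 \<longrightarrow> w (Y 1) = 0) \<and> (b = 1 \<longrightarrow> w (X 1) = 0)"
      using y w unfolding homog_def by fastforce
    have "?b x (?b y w) = smul (2 * (w (Y 1) * y (Y 1))) (?R (?R x))"
      unfolding br[OF x bV] Y X by (auto simp: smul_def)
    also have "\<dots> = ?b (?b x y) w - smul ((- 1) ^ (a * b)) (?b (?b x w) y)"
      unfolding br[of "?b x w" y, OF bV yw(1)] br[of "?b x y" w, OF bV yw(2)]
      unfolding br[OF x yw(1)] br[OF x yw(2)] R3 R4
      using parity ab by (auto simp: smul_def fun_eq_iff algebra_simps)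
    finally show "?b x (?b y w) = ?b (?b x y) w - smul ((- 1) ^ (a * b)) (?b (?b x w) y)" .
  qed (use bh in auto)
qed

end

section \<open>The sequence generated by an odd element of a Leibniz law\<close>

lemma cyc_seq_homog:
  assumes \<mu>: "\<mu> \<in> Leib n m" and y: "y \<in> homog n m 1"
  shows "cyc_seq n m \<mu> y j \<in> homog n m (Suc j mod 2)"
proof (induction j)
  case (Suc j)
  have "bracket n m \<mu> (cyc_seq n m \<mu> y j) y \<in> homog n m ((Suc j mod 2 + 1) mod 2)"
    using Leib_grading[OF \<mu> Suc y] by (auto simp: mod2_eq_if)
  then show ?case by (auto intro!: homog_smul simp: mod_Suc_eq)
qed (use y in simp)

lemma cyc_seq_gr_space:
  assumes "\<mu> \<in> Leib n m" "y \<in> homog n m 1"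
  shows "cyc_seq n m \<mu> y j \<in> gr_space n m"
  using homog_subset cyc_seq_homog[OF assms] by (rule subsetD)

text \<open>The Leibniz identity for the pair of odd arguments \<open>y, y\<close>, whose sign makes
  the two terms add up.\<close>

lemma bracket_cyc_seq_1:
  assumes \<mu>: "\<mu> \<in> Leib n m" and y: "y \<in> homog n m 1" and u: "u \<in> gr_space n m"
  shows "bracket n m \<mu> u (cyc_seq n m \<mu> y (Suc 0)) = smul 2 (bracket n m \<mu> (bracket n m \<mu> u y) y)"
  using Leib_identity[OF \<mu> u y y] by (auto simp: smul_def)

text \<open>Every later element of the sequence is a bracket of an earlier one, acting on the right as a
  multiple of \<open>R\<close> or \<open>R\<^sup>2\<close>, with \<open>y\<close>; so it acts by a commutator of powers of \<open>R\<close>.\<close>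

lemma bracket_cyc_seq_bracket:
  assumes \<mu>: "\<mu> \<in> Leib n m" and y: "y \<in> homog n m 1"
  shows "1 \<le> j \<Longrightarrow> u \<in> gr_space n m \<Longrightarrow>
    bracket n m \<mu> u (bracket n m \<mu> (cyc_seq n m \<mu> y j) y) = 0"
proof (induction j arbitrary: u rule: dec_induct)
  note aff = Leib_affine[OF \<mu>]
  note bV = bracket_gr_space[OF aff]
  have id: "bracket n m \<mu> u (bracket n m \<mu> (cyc_seq n m \<mu> y j) y) =
      bracket n m \<mu> (bracket n m \<mu> u (cyc_seq n m \<mu> y j)) y -
      smul ((- 1) ^ (Suc j mod 2 * 1)) (bracket n m \<mu> (bracket n m \<mu> u y) (cyc_seq n m \<mu> y j))"
    if "u \<in> gr_space n m" for u j
    using that by (rule Leib_identity[OF \<mu> _ cyc_seq_homog[OF \<mu> y] y]) (auto simp: mod2_eq_if)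
  {
    \<comment> \<open>The element \<open>[y, y]\<close> is even and acts as
      \<open>2 R\<^sup>2\<close>, so its bracket with \<open>y\<close> acts by the commutator of
      \<open>2 R\<^sup>2\<close> and \<open>R\<close>.\<close>
    case base
    have "bracket n m \<mu> (smul 2 (bracket n m \<mu> (bracket n m \<mu> u y) y)) y =
        smul 2 (bracket n m \<mu> (bracket n m \<mu> (bracket n m \<mu> u y) y) y)"
      using aff bV by (rule bracket_smul_left)
    then show ?case
      using id[OF base, of 1] bracket_cyc_seq_1[OF \<mu> y base] bracket_cyc_seq_1[OF \<mu> y bV[of u y]]
      by (simp add: smul_simps)
  next
    case (step j)
    \<comment> \<open>By induction the next element already acts by zero, and then so does its
      bracket with \<open>y\<close>, since both terms of the identity vanish.\<close>
    have "bracket n m \<mu> w (cyc_seq n m \<mu> y (Suc j)) = 0" if "w \<in> gr_space n m" for w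
      using step.IH[OF that] bracket_smul_right[OF aff bV] by (simp add: smul_simps zero_fun_def)
    then show ?case
      using id[OF step.prems, of "Suc j"] step.prems bV by (simp add: bracket_0_left smul_simps del: cyc_seq.simps)
  }
qed

lemma bracket_cyc_seq:
  assumes \<mu>: "\<mu> \<in> Leib n m" and y: "y \<in> homog n m 1" and u: "u \<in> gr_space n m" and j: "2 \<le> j"
  shows "bracket n m \<mu> u (cyc_seq n m \<mu> y j) = 0"
proof -
  obtain i where i: "j = Suc i" "1 \<le> i" using j by (cases j) auto
  note aff = Leib_affine[OF \<mu>]
  show ?thesis
    using bracket_cyc_seq_bracket[OF \<mu> y i(2) u]
      bracket_smul_right[OF aff bracket_gr_space[OF aff]] by (simp add: i smul_simps zero_fun_def)
qed

context interleaved
begin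

text \<open>Only the first two elements of the sequence act nontrivially on the right, as
  \<open>R\<close> and \<open>2 R\<^sup>2\<close>. This is the same formula as for
  \<open>cyc_law\<close>.\<close>

lemma bracket_comb_cyc_seq:
  assumes \<mu>: "\<mu> \<in> Leib n m" and y: "y \<in> homog n m 1" and u: "u \<in> V"
  shows "bracket n m \<mu> u (comb N (cyc_seq n m \<mu> y) x) =
    smul (x (Y 1)) (bracket n m \<mu> u y) + smul (2 * x (X 1)) (bracket n m \<mu> (bracket n m \<mu> u y) y)"
proof -
  let ?b = "bracket n m \<mu>" and ?v = "cyc_seq n m \<mu> y"
  have "?b u (comb N ?v x) = (\<lambda>k. \<Sum>j<N. x (enum_gen j) * ?b u (?v j) k)"
    unfolding comb_def
    by (rule linear_on_gr_sum[OF bracket_linear_right[OF Leib_affine[OF \<mu>]]])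
       (rule cyc_seq_gr_space[OF \<mu> y])
  also have "\<dots> = (\<lambda>k. \<Sum>j<N. (if j = 0 then x (Y 1) * ?b u y k else 0) +
      (if j = 1 then 2 * x (X 1) * ?b (?b u y) y k else 0))"
  proof (intro ext sum.cong refl)
    fix k and j :: nat
    consider "j = 0" | "j = 1" | "2 \<le> j" by linarith
    then show "x (enum_gen j) * ?b u (?v j) k = (if j = 0 then x (Y 1) * ?b u y k else 0) +
      (if j = 1 then 2 * x (X 1) * ?b (?b u y) y k else 0)"
    proof cases
      case 1
      then show ?thesis by (simp add: enum_gen_01)
    next
      case 2
      then show ?thesis
        using bracket_cyc_seq_1[OF \<mu> y u] by (simp del: cyc_seq.simps add: enum_gen_01 smul_def)
    next
      case 3
      then show ?thesis using bracket_cyc_seq[OF \<mu> y u] by simp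
    qed
  qed
  finally show ?thesis
    using n_ge_1 m_cases by (auto simp: sum.distrib smul_def)
qed

text \<open>The sequence generated by \<open>y\<close> is a homogeneous basis. In it the law
  coincides with \<open>cyc_law n m z\<close>, where \<open>z\<close> holds the coordinates of the
  vector following the last one.\<close>

lemma Leib_cyclic_imp_Orb:
  fixes \<mu> :: "gen \<times> gen \<times> gen \<Rightarrow> 'a::field_char_0"
  assumes \<mu>: "\<mu> \<in> Leib n m" and y: "y \<in> homog n m 1"
    and d: "det (gen_mat N (cyc_seq n m \<mu> y)) \<noteq> 0"
  shows "\<exists>z\<in>cyc_params n m. \<mu> \<in> Orb n m (cyc_law n m z)"
proof -
  let ?b = "bracket n m \<mu>" and ?v = "cyc_seq n m \<mu> y" and ?f = "comb N (cyc_seq n m \<mu> y)"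
  let ?h = "inv_into V ?f"
  note aff = Leib_affine[OF \<mu>]
  note bV = bracket_gr_space[OF aff] and vV = cyc_seq_gr_space[OF \<mu> y]
  have yV: "y \<in> V" using y homog_subset by auto
  have f: "?f \<in> graded_GL n m"
    using cyc_seq_homog[OF \<mu> y] d by (rule comb_graded_GL)
  have lin: "linear_on_gr n m ?f" using f by (rule graded_GL_linear)
  have bij: "bij_betw ?f V V" using f unfolding graded_GL_def by simp
  have f_eq_0: "u = 0" if "?f u = 0" "u \<in> V" for u
  proof -
    have "?f 0 = 0" by (simp add: comb_def fun_eq_iff)
    then show ?thesis using bij that gr_space_0 unfolding bij_betw_def inj_on_def by metis
  qed
  \<comment> \<open>The bracket is taken without the factor of \<open>cyc_seq\<close>, in agreement
    with the last case of \<open>cyc_image\<close>.\<close>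
  define z where "z = ?h (?b (?v (N - 1)) y)"
  have fz: "?f z = ?b (?v (N - 1)) y" and zV: "z \<in> V"
    using bij bV unfolding z_def by (auto simp: bij_betw_def inv_into_into f_inv_into_f)
  have "?b (?v (N - 1)) y \<in> homog n m ((Suc (N - 1) mod 2 + 1) mod 2)"
    by (rule Leib_grading[OF \<mu> cyc_seq_homog[OF \<mu> y] y]) (auto simp: mod2_eq_if)
  moreover have "Suc (N - 1) = N" using N_ge_2 by simp
  ultimately have "?b (?v (N - 1)) y \<in> homog n m (Suc N mod 2)"
    by (simp only: mod_Suc_eq flip: Suc_eq_plus1)
  then have zh: "z \<in> homog n m (Suc N mod 2)"
    unfolding z_def by (rule graded_GL_homog[OF graded_GL_inv_into[OF f]]) (auto simp: mod2_eq_if)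
  \<comment> \<open>The vector \<open>?f z\<close> acts by zero. Applied to \<open>y\<close>, this
    is a linear relation between the elements 1 and 2 of the sequence, whose coefficients are the
    two coordinates of \<open>z\<close> in question.\<close>
  have "?b y (?f z) = 0"
    unfolding fz using N_ge_2 by (intro bracket_cyc_seq_bracket[OF \<mu> y _ yV]) auto
  then have zero: "smul (z (Y 1)) (?v 1) + smul (z (X 1)) (?v 2) = 0"
    unfolding bracket_comb_cyc_seq[OF \<mu> y yV]
    by (simp add: numeral_2_eq_2 smul_simps mult.commute)
  have "z (Y 1) = 0 \<and> z (X 1) = 0"
  \<comment> \<open>Here element 2 lies beyond the basis, so the relation alone does not suffice;
    the coordinate at \<open>X 1\<close> vanishes because \<open>z\<close> is odd.\<close>
  proof (cases "N = 2")
    case True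
    then have X: "z (X 1) = 0" using zh unfolding homog_def by fastforce
    have "?f (smul (z (Y 1)) (basis_vec (enum_gen 1))) = smul (z (Y 1)) (?f (basis_vec (enum_gen 1)))"
      using lin True unfolding linear_on_gr_def by (simp add: basis_vec_gr_space enum_gen_in_gens)
    moreover have "?f (basis_vec (enum_gen 1)) = ?v 1"
      using True by (intro comb_basis) simp
    ultimately have "?f (smul (z (Y 1)) (basis_vec (enum_gen 1))) = 0"
      using zero unfolding X by (simp add: smul_simps del: cyc_seq.simps)
    then have "smul (z (Y 1)) (basis_vec (enum_gen 1)) = 0"
      by (rule f_eq_0[OF _ gr_space_smul]) (use True in \<open>simp add: basis_vec_gr_space enum_gen_in_gens\<close>)
    from fun_cong[OF this, of "enum_gen 1"] X show ?thesis by (simp add: smul_def basis_vec_def)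
  next
    case False
    then have N3: "2 < N" using N_ge_2 by simp
    let ?e = "\<lambda>j. basis_vec (enum_gen j) :: gen \<Rightarrow> 'a"
    let ?w = "smul (z (Y 1)) (?e 1) + smul (z (X 1)) (?e 2)"
    have e: "?e 1 \<in> V" "?e 2 \<in> V" using N3 by (simp_all add: basis_vec_gr_space enum_gen_in_gens)
    have "?f ?w = smul (z (Y 1)) (?f (?e 1)) + smul (z (X 1)) (?f (?e 2))"
      using lin e gr_space_smul[OF e(1)] gr_space_smul[OF e(2)] unfolding linear_on_gr_def by simp
    also have "\<dots> = 0"
      using zero N3 by (simp add: comb_basis del: cyc_seq.simps)
    finally have "?w = 0"
      by (rule f_eq_0) (intro gr_space_add gr_space_smul e)
    from fun_cong[OF this, of "enum_gen 1"] fun_cong[OF this, of "enum_gen 2"] show ?thesis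
      by (simp add: smul_def basis_vec_def)
  qed
  then have zp: "z \<in> cyc_params n m" using zh unfolding cyc_params_def by simp
  \<comment> \<open>The base change intertwines \<open>cyc_op N z\<close> with right multiplication
    by \<open>y\<close>. On the basis the factors in \<open>cyc_image\<close> and
    \<open>cyc_seq\<close> cancel.\<close>
  have fR: "?f (cyc_op N z u) = ?b (?f u) y" if u: "u \<in> V" for u
  proof (rule linear_on_gr_eqI[OF linear_on_gr_comp[OF lin cyc_op_linear[OF zV]]
        linear_on_gr_comp[OF bracket_linear_left[OF aff] lin] _ u])
    fix g assume "g \<in> gens n m"
    then obtain j where j: "g = enum_gen j" "j < N" unfolding gens_enum by auto
    show "?f (cyc_op N z (basis_vec g)) = ?b (?f (basis_vec g)) y"
      unfolding j(1) cyc_op_basis[OF j(2)] comb_basis[OF j(2)]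
    proof (cases "Suc j < N")
      case True
      let ?e = "basis_vec (enum_gen (Suc j)) :: gen \<Rightarrow> 'a"
      have e: "?e \<in> V" using True by (simp add: basis_vec_gr_space enum_gen_in_gens)
      have "?f (cyc_image N z j) = smul (if even j then 1 else 1 / 2) (?v (Suc j))"
        using lin e True unfolding cyc_image_def linear_on_gr_def
        by (simp add: comb_basis del: cyc_seq.simps)
      then show "?f (cyc_image N z j) = ?b (?v j) y" by (simp add: smul_simps)
    next
      case False
      then have "j = N - 1" using j by simp
      then show "?f (cyc_image N z j) = ?b (?v j) y"
        using fz False by (simp add: cyc_image_def)
    qed
  qed
  have "law_iso n m ?f (cyc_law n m z) \<mu>"
    unfolding law_iso_def
  proof (intro conjI f ballI)
    fix u w :: "gen \<Rightarrow> 'a" assume u: "u \<in> V" and w: "w \<in> V"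
    let ?R = "cyc_op N z"
    note RV = cyc_op_gr_space[OF zV]
    have fu: "?f u \<in> V" using lin u unfolding linear_on_gr_def by simp
    have "?f (bracket n m (cyc_law n m z) u w) =
        smul (w (Y 1)) (?f (?R u)) + smul (2 * w (X 1)) (?f (?R (?R u)))"
      unfolding bracket_cyc_law[OF zV u w]
      using lin RV gr_space_smul[OF RV] unfolding linear_on_gr_def by simp
    also have "\<dots> = ?b (?f u) (?f w)"
      unfolding bracket_comb_cyc_seq[OF \<mu> y fu] fR[OF u] fR[OF RV] ..
    finally show "?f (bracket n m (cyc_law n m z) u w) = ?b (?f u) (?f w)" .
  qed
  then have "law_iso n m ?h \<mu> (cyc_law n m z)"
    by (rule law_iso_inv_into[OF _ cyc_law_affine])
  then show ?thesis
    using Orb_iff_law_iso[OF cyc_law_affine] aff zp by blast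
qed

text \<open>An isomorphism carries \<open>Y 1\<close>, which is cyclic for \<open>cyc_law\<close>,
  to a cyclic element of the given law; the determinant is then that of the isomorphism.\<close>

lemma Orb_imp_Leib_cyclic:
  fixes \<mu> :: "gen \<times> gen \<times> gen \<Rightarrow> 'a::field_char_0"
  assumes z: "z \<in> cyc_params n m" and \<mu>: "\<mu> \<in> Orb n m (cyc_law n m z)"
  shows "\<mu> \<in> Leib n m" "\<exists>y\<in>homog n m 1. det (gen_mat N (cyc_seq n m \<mu> y)) \<noteq> 0"
proof -
  obtain f where f: "law_iso n m f \<mu> (cyc_law n m z)" and aff: "\<mu> \<in> affine_space (coords n m)"
    using \<mu> Orb_iff_law_iso[OF cyc_law_affine] by blast
  show "\<mu> \<in> Leib n m"
    using f cyc_law_Leib[OF z] aff by (rule Leib_law_iso)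
  let ?h = "inv_into V f" and ?e = "\<lambda>j. basis_vec (enum_gen j) :: gen \<Rightarrow> 'a"
  have zV: "z \<in> V" using z homog_subset unfolding cyc_params_def by auto
  have iso: "law_iso n m ?h (cyc_law n m z) \<mu>" using f aff by (rule law_iso_inv_into)
  then have h: "?h \<in> graded_GL n m" unfolding law_iso_def by simp
  have eV: "?e j \<in> V" if "j < N" for j
    using that by (simp add: basis_vec_gr_space enum_gen_in_gens)
  have e0: "?e 0 \<in> V" using n_ge_1 by (intro eV) simp
  have seq: "cyc_seq n m \<mu> (?h (?e 0)) j = ?h (?e j)" if "j < N" for j
    using that
  proof (induction j)
    case (Suc j)
    let ?s = "if even j then 1 else 1 / 2 :: 'a" and ?t = "if even j then 1 else 2 :: 'a"
    have "bracket n m \<mu> (?h (?e j)) (?h (?e 0)) = ?h (bracket n m (cyc_law n m z) (?e j) (?e 0))"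
      using iso eV[of j] e0 Suc.prems unfolding law_iso_def by simp
    also have "bracket n m (cyc_law n m z) (?e j) (?e 0) = cyc_op N z (?e j)"
      using eV[of j] e0 Suc.prems unfolding enum_gen_01(1)
      by (subst bracket_cyc_law[OF zV]) (auto simp: basis_vec_def smul_def)
    also have "\<dots> = smul ?s (?e (Suc j))"
      using Suc.prems by (simp add: cyc_op_basis cyc_image_def)
    also have "?h \<dots> = smul ?s (?h (?e (Suc j)))"
      using graded_GL_linear[OF h] eV[OF Suc.prems] unfolding linear_on_gr_def by blast
    finally show ?case
      using Suc by (simp add: smul_simps)
  qed simp
  have "gen_mat N (cyc_seq n m \<mu> (?h (?e 0))) = gen_mat N (\<lambda>j. ?h (?e j))"
    unfolding gen_mat_def using seq by (intro cong_mat) auto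
  moreover have "?h (?e 0) \<in> homog n m 1"
  proof -
    have "?e 0 \<in> homog n m 1" unfolding enum_gen_01(1) by (rule basis_vec_homog[OF Y1_gens]) simp
    then show ?thesis using graded_GL_homog[OF h] by simp
  qed
  ultimately show "\<exists>y\<in>homog n m 1. det (gen_mat N (cyc_seq n m \<mu> y)) \<noteq> 0"
    using det_gen_mat_ne_0[OF h] by (intro bexI[of _ "?h (?e 0)"]) simp_all
qed

section \<open>The laws with a cyclic odd element form an open subset\<close>

definition cyc_orbits :: "(gen \<times> gen \<times> gen \<Rightarrow> 'a::field_char_0) set" where
  "cyc_orbits = (\<Union>z\<in>cyc_params n m. Orb n m (cyc_law n m z))"

lemma cyc_orbits_eq:
  "cyc_orbits = Leib n m -
     {\<mu> \<in> affine_space (coords n m). \<forall>y\<in>homog n m 1. det (gen_mat N (cyc_seq n m \<mu> y)) = 0}"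
  unfolding cyc_orbits_def
  using Leib_cyclic_imp_Orb Orb_imp_Leib_cyclic Leib_affine by blast

lemma cyc_seq_polynomial:
  assumes "k \<in> gens n m"
  shows "(\<lambda>\<mu>. cyc_seq n m \<mu> y j k) \<in> polynomial_functions (coords n m)"
  using assms
proof (induction j arbitrary: k)
  case (Suc j)
  then show ?case
    unfolding cyc_seq.simps smul_def bracket_def
    by (intro polyfun.mult polyfun.const polyfun.sum polynomial_functions_coord)
       (auto simp: coords_def)
qed (simp add: polyfun.const)

text \<open>For each fixed \<open>y\<close> the determinant is a polynomial in the structure
  constants; all these polynomials together cut out the set.\<close>

lemma closedin_not_cyclic:
  "closedin (zariski (coords n m))
     {\<mu> \<in> affine_space (coords n m). \<forall>y\<in>homog n m 1. det (gen_mat N (cyc_seq n m \<mu> y)) = 0}"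
proof -
  let ?G = "(\<lambda>y \<mu>. det (gen_mat N (cyc_seq n m \<mu> y))) ` homog n m 1"
  have "?G \<subseteq> polynomial_functions (coords n m)"
  proof (rule image_subsetI)
    fix y
    show "(\<lambda>\<mu>. det (gen_mat N (cyc_seq n m \<mu> y))) \<in> polynomial_functions (coords n m)"
    proof (rule polyfun.det[OF gen_mat_carrier])
      fix i j assume "i < N" "j < N"
      then show "(\<lambda>\<mu>. gen_mat N (cyc_seq n m \<mu> y) $$ (i, j)) \<in> polynomial_functions (coords n m)"
        by (simp add: gen_mat_index cyc_seq_polynomial enum_gen_in_gens)
    qed
  qed
  then have "closedin (zariski (coords n m)) {\<mu> \<in> affine_space (coords n m). \<forall>g\<in>?G. g \<mu> = 0}"
    by (rule closedin_zariski_polynomial_functions)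
  then show ?thesis by simp
qed

end

section \<open>Irreducibility of the union of the orbits\<close>

text \<open>An automorphism and the \<open>comb\<close> built from its columns agree only on the
  graded space, which is all that the action sees.\<close>

lemma act_cong:
  assumes "\<And>u. u \<in> gr_space n m \<Longrightarrow> f u = h u"
  shows "act n m f \<mu> = act n m h \<mu>"
proof -
  have inv: "inv_into (gr_space n m) f = inv_into (gr_space n m) h"
    unfolding inv_into_def using assms by (intro ext arg_cong[where f = Eps]) auto
  have "act n m f \<mu> x = act n m h \<mu> x" for x
    unfolding act_def structure_constants_def inv using assms
    by (cases x) (simp add: coords_def basis_vec_gr_space)
  then show ?thesis by auto
qed

lemma comb_path:
  assumes "\<And>j g. j < N \<Longrightarrow> (\<lambda>t. v t j g) \<in> polynomial_paths"
    and "\<And>g. (\<lambda>t. u t g) \<in> polynomial_paths"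
  shows "(\<lambda>t. comb N (v t) (u t) g) \<in> polynomial_paths"
  unfolding comb_def using assms by (intro polypath.sum polypath.mult) auto

lemma bracket_path:
  assumes "\<And>x. (\<lambda>t. \<mu> t x) \<in> polynomial_paths" "\<And>g. (\<lambda>t. u t g) \<in> polynomial_paths"
    "\<And>g. (\<lambda>t. w t g) \<in> polynomial_paths"
  shows "(\<lambda>t. bracket n m (\<mu> t) (u t) (w t) g) \<in> polynomial_paths"
  unfolding bracket_def using assms by (intro polypath.sum polypath.mult) auto

lemma gen_adj_path:
  assumes "\<And>j g. j < N \<Longrightarrow> (\<lambda>t. v t j g) \<in> polynomial_paths"
    and "\<And>g. (\<lambda>t. u t g) \<in> polynomial_paths"
  shows "(\<lambda>t. gen_adj N (v t) (u t) g) \<in> polynomial_paths"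
  unfolding gen_adj_def using assms
  by (intro polypath.sum polypath.mult polypath.const polypath.adj_mat[OF gen_mat_carrier])
     (auto simp: gen_mat_index)

lemma det_gen_mat_path:
  assumes "\<And>j g. j < N \<Longrightarrow> (\<lambda>t. v t j g) \<in> polynomial_paths"
  shows "(\<lambda>t. det (gen_mat N (v t))) \<in> polynomial_paths"
  using assms by (intro polypath.det[OF gen_mat_carrier]) (simp add: gen_mat_index)

text \<open>The operator depends polynomially on \<open>z\<close>, and so does its square, the only
  other ingredient of the structure constants.\<close>

lemma cyc_law_path:
  assumes "\<And>g. (\<lambda>t. z t g) \<in> polynomial_paths"
  shows "(\<lambda>t. cyc_law n m (z t) x) \<in> polynomial_paths"
proof -
  obtain i j k where x: "x = (i, j, k)" by (cases x)
  have im: "(\<lambda>t. cyc_image (n + m) (z t) j g) \<in> polynomial_paths" for j g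
    using assms unfolding cyc_image_def by (cases "Suc j < n + m") (auto intro: polypath.const)
  have R: "(\<lambda>t. cyc_op (n + m) (z t) (u t) g) \<in> polynomial_paths"
    if "\<And>g. (\<lambda>t. u t g) \<in> polynomial_paths" for u g
    unfolding cyc_op_def using im that by (rule comb_path)
  have "(\<lambda>t. cyc_op (n + m) (z t) (basis_vec i) g) \<in> polynomial_paths" for g
    by (intro R polypath.const)
  then show ?thesis
    unfolding x cyc_law_def structure_constants_def
    by (cases "(i, j, k) \<in> coords n m"; cases "j = Y 1"; cases "j = X 1")
       (auto intro!: polypath.mult polypath.const R)
qed

context interleaved
begin

lemma cyc_orbits_act:
  "\<mu> \<in> cyc_orbits \<longleftrightarrow> (\<exists>z\<in>cyc_params n m. \<exists>f\<in>graded_GL n m. \<mu> = act n m f (cyc_law n m z))"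
  unfolding cyc_orbits_def Orb_def by auto

text \<open>All coordinates of the transformed law get the common denominator
  \<open>det (gen_mat N v)\<close>, the form that rational curves require.\<close>

lemma act_comb:
  assumes v: "\<And>j. j < N \<Longrightarrow> v j \<in> V" and d: "det (gen_mat N v) \<noteq> 0"
    and \<mu>: "\<mu> \<in> affine_space (coords n m)"
  shows "act n m (comb N v) \<mu> (i, j, k) =
    (if (i, j, k) \<in> coords n m
     then gen_adj N v (bracket n m \<mu> (comb N v (basis_vec i)) (comb N v (basis_vec j))) k
     else 0) / det (gen_mat N v)"
  unfolding act_def structure_constants_def
  using comb_inv_into[OF v d bracket_gr_space[OF \<mu>]] by (simp add: smul_def)

lemma irreducible_cyc_orbits:
  "irreducible_subset (zariski (coords n m)) (cyc_orbits :: (_ \<Rightarrow> 'a::field_char_0) set)"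
proof (rule irreducible_subset_zariski_if_rational_paths)
  show "cyc_orbits \<subseteq> (affine_space (coords n m) :: (_ \<Rightarrow> 'a) set)"
    unfolding cyc_orbits_eq using Leib_affine by blast
  have "(\<lambda>u. u) \<in> (graded_GL n m :: ((gen \<Rightarrow> 'a) \<Rightarrow> _) set)"
    unfolding graded_GL_def by (simp add: bij_betw_def)
  moreover have "(\<lambda>_. 0) \<in> (cyc_params n m :: (gen \<Rightarrow> 'a) set)"
    unfolding cyc_params_def homog_def gr_space_def by simp
  ultimately show "cyc_orbits \<noteq> ({} :: (_ \<Rightarrow> 'a) set)"
    using cyc_orbits_act by blast
next
  fix u1 u2 :: "gen \<times> gen \<times> gen \<Rightarrow> 'a"
  assume "u1 \<in> cyc_orbits" "u2 \<in> cyc_orbits"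
  then obtain z1 z2 f1 f2 where z: "z1 \<in> cyc_params n m" "z2 \<in> cyc_params n m"
    and f: "f1 \<in> graded_GL n m" "f2 \<in> graded_GL n m"
    and u: "u1 = act n m f1 (cyc_law n m z1)" "u2 = act n m f2 (cyc_law n m z2)"
    unfolding cyc_orbits_act by blast
  let ?e = "\<lambda>j. basis_vec (enum_gen j) :: gen \<Rightarrow> 'a"
  \<comment> \<open>The columns of the base change and the parameter vector move along straight
    lines; \<open>d\<close> and \<open>w\<close> become the denominator and the numerators of the
    resulting curve of laws.\<close>
  define v where "v t j = smul (1 - t) (f1 (?e j)) + smul t (f2 (?e j))" for t j
  define y where "y t = smul (1 - t) z1 + smul t z2" for t
  define d where "d t = det (gen_mat N (v t))" for t
  define w where "w = (\<lambda>(i, j, k) t. if (i, j, k) \<in> coords n m then gen_adj N (v t)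
      (bracket n m (cyc_law n m (y t)) (comb N (v t) (basis_vec i)) (comb N (v t) (basis_vec j))) k
      else 0)"
  have line: "(\<lambda>t. (smul (1 - t) a + smul t b) g) \<in> polynomial_paths" for a b :: "gen \<Rightarrow> 'a" and g
    unfolding smul_def plus_fun_def
    by (intro polypath.add polypath.mult polypath.diff polypath.const polynomial_path_id)
  have vp: "(\<lambda>t. v t j g) \<in> polynomial_paths" for j g
    unfolding v_def by (rule line)
  have yp: "(\<lambda>t. y t g) \<in> polynomial_paths" for g
    unfolding y_def by (rule line)
  have e: "?e j \<in> homog n m (Suc j mod 2)" if "j < N" for j
    using that by (simp add: basis_vec_homog enum_gen_in_gens deg_enum_gen)
  have vh: "v t j \<in> homog n m (Suc j mod 2)" if "j < N" for t j
    unfolding v_def using graded_GL_homog[OF f(1) e[OF that]] graded_GL_homog[OF f(2) e[OF that]]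
    by (intro homog_add homog_smul) (auto simp: mod2_eq_if)
  then have vV: "v t j \<in> V" if "j < N" for t j
    using that homog_subset by blast
  \<comment> \<open>The parameter set is a linear subspace, so the segment never leaves it.\<close>
  have yh: "y t \<in> cyc_params n m" for t
  proof -
    have "y t \<in> homog n m (Suc N mod 2)"
      using z unfolding y_def cyc_params_def by (intro homog_add homog_smul) auto
    then show ?thesis using z unfolding y_def cyc_params_def by (simp add: smul_def)
  qed
  have rat: "(\<lambda>x. w x t / d t) = act n m (comb N (v t)) (cyc_law n m (y t))" if "d t \<noteq> 0" for t
    using act_comb[of "v t" "cyc_law n m (y t)", OF vV] that cyc_law_affine[of n m "y t"]
    unfolding d_def w_def by auto
  have comb: "comb N (\<lambda>j. f (?e j)) u = f u" if "f \<in> graded_GL n m" "u \<in> V" for f u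
    unfolding linear_on_gr_expansion[OF graded_GL_linear[OF that(1)] that(2)] comb_def sum_gens ..
  have v01: "v 0 = (\<lambda>j. f1 (?e j))" "v 1 = (\<lambda>j. f2 (?e j))" and y01: "y 0 = z1" "y 1 = z2"
    unfolding v_def y_def by (auto simp: smul_def fun_eq_iff)
  have d01: "d 0 \<noteq> 0" "d 1 \<noteq> 0"
    unfolding d_def v01 by (intro det_gen_mat_ne_0 f)+
  show "\<exists>d w. d \<in> polynomial_paths \<and> (\<forall>v. w v \<in> polynomial_paths) \<and> d 0 \<noteq> 0 \<and> d 1 \<noteq> 0 \<and>
      (\<lambda>v. w v 0 / d 0) = u1 \<and> (\<lambda>v. w v 1 / d 1) = u2 \<and>
      (\<forall>t. d t \<noteq> 0 \<longrightarrow> (\<lambda>v. w v t / d t) \<in> cyc_orbits)"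
  proof (intro exI[of _ d] exI[of _ w] conjI d01 allI impI)
    show "d \<in> polynomial_paths"
      unfolding d_def using vp by (intro det_gen_mat_path)
    show "w x \<in> polynomial_paths" for x
    proof -
      obtain i j k where x: "x = (i, j, k)" by (cases x)
      have "(\<lambda>t. gen_adj N (v t) (bracket n m (cyc_law n m (y t)) (comb N (v t) (basis_vec i))
          (comb N (v t) (basis_vec j))) k) \<in> polynomial_paths"
        by (intro gen_adj_path bracket_path cyc_law_path comb_path vp yp polypath.const)
      then show ?thesis
        unfolding x w_def by (cases "(i, j, k) \<in> coords n m") (auto intro: polypath.const)
    qed
    show "(\<lambda>x. w x 0 / d 0) = u1"
      unfolding rat[OF d01(1)] u v01 y01 by (intro act_cong comb f)
    show "(\<lambda>x. w x 1 / d 1) = u2"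
      unfolding rat[OF d01(2)] u v01 y01 by (intro act_cong comb f)
    show "(\<lambda>x. w x t / d t) \<in> cyc_orbits" if "d t \<noteq> 0" for t
      unfolding rat[OF that] cyc_orbits_act
      using yh comb_graded_GL[of "v t", OF vh] that unfolding d_def by blast
  qed
qed

lemma irreducible_component_cyc_orbits:
  "irreducible_component (subtopology (zariski (coords n m)) (Leib n m))
     (zariski (coords n m) closure_of (cyc_orbits :: (_ \<Rightarrow> 'a::field_char_0) set))"
  by (rule irreducible_component_closure_of[OF closedin_Leib irreducible_cyc_orbits _
        closedin_not_cyclic cyc_orbits_eq]) (simp add: cyc_orbits_eq)

text \<open>\<open>Y a\<close> stands at position \<open>2 * a - 2\<close> and is followed by
  \<open>X a\<close>, except for \<open>a = n + 1\<close>, when it is the last basis vector.\<close>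

lemma cyc_op_Y:
  assumes "Y a \<in> gens n m"
  shows "cyc_op N z (basis_vec (Y a)) = (if a \<le> n then basis_vec (X a) else z)"
proof -
  have "1 \<le> a" "a \<le> m" using assms unfolding gens_def by auto
  then have "Y a = enum_gen (2 * a - 2)" "X a = enum_gen (Suc (2 * a - 2))" "2 * a - 2 < N"
    "Suc (2 * a - 2) < N \<longleftrightarrow> a \<le> n" "even (2 * a - 2)"
    using m_cases by (auto simp: enum_gen_def)
  then show ?thesis by (simp add: cyc_op_basis cyc_image_def smul_simps)
qed

text \<open>\<open>X a\<close> stands at position \<open>2 * a - 1\<close> and is last exactly when
  \<open>a = m\<close>, which forces \<open>m = n\<close>.\<close>

lemma cyc_op_X:
  assumes "X a \<in> gens n m"
  shows "cyc_op N z (basis_vec (X a)) = (if a < m then smul (1 / 2) (basis_vec (Y (Suc a))) else z)"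
proof -
  have "1 \<le> a" "a \<le> n" using assms unfolding gens_def by auto
  then have "X a = enum_gen (2 * a - 1)" "Y (Suc a) = enum_gen (Suc (2 * a - 1))" "2 * a - 1 < N"
    "Suc (2 * a - 1) < N \<longleftrightarrow> a < m" "odd (2 * a - 1)"
    using m_cases by (auto simp: enum_gen_def)
  then show ?thesis by (simp add: cyc_op_basis cyc_image_def)
qed

lemma cyc_op_smul: "z \<in> V \<Longrightarrow> u \<in> V \<Longrightarrow> cyc_op N z (smul s u) = smul s (cyc_op N z u)"
  using cyc_op_linear[of z] unfolding linear_on_gr_def by blast

end

section \<open>The two families\<close>

lemma structure_constants_cong:
  assumes "\<And>i j. i \<in> gens n m \<Longrightarrow> j \<in> gens n m \<Longrightarrow> P i j = Q i j"
  shows "structure_constants n m P = structure_constants n m Q"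
  using assms unfolding structure_constants_def coords_def by auto

lemma double_half: "2 * smul (1 / 2) u g = u g" for u :: "gen \<Rightarrow> 'a::field_char_0"
  by (simp add: smul_def)

text \<open>The last basis vector is \<open>X n\<close>, so \<open>z\<close> is the product
  \<open>[X n, Y 1]\<close>. The products with \<open>X 1\<close> are those of
  \<open>2 R\<^sup>2\<close>; for \<open>X n\<close> this is twice \<open>R z\<close>, computed from
  \<open>R (Y k) = X k\<close>.\<close>

lemma nu_eq_cyc_law:
  fixes b :: "nat \<Rightarrow> 'a::field_char_0"
  assumes n: "1 \<le> n"
  shows "nu n b = cyc_law n n (\<Sum>k=2..n. smul (b k) (basis_vec (Y k)))"
proof -
  interpret interleaved n n using n by unfold_locales auto
  define z :: "gen \<Rightarrow> 'a" where "z = (\<Sum>k=2..n. smul (b k) (basis_vec (Y k)))"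
  have YV: "(basis_vec (Y k) :: gen \<Rightarrow> 'a) \<in> V" if "k \<in> {1..n}" for k
    using that by (auto intro!: basis_vec_gr_space simp: gens_def)
  define R where "R = cyc_op N z"
  have zV: "z \<in> V" unfolding z_def sum_smul using YV by (intro gr_space_sum) auto
  have RY: "R (basis_vec (Y i)) = basis_vec (X i)" if "i \<in> {1..n}" for i
    using that unfolding R_def by (subst cyc_op_Y) (auto simp: gens_def)
  have RX: "R (basis_vec (X i)) = (if i < n then smul (1 / 2) (basis_vec (Y (Suc i))) else z)"
    if "i \<in> {1..n}" for i
    using that unfolding R_def by (subst cyc_op_X) (auto simp: gens_def)
  have Rz: "R z = (\<Sum>k=2..n. smul (b k) (basis_vec (X k)))"
  proof -
    have "R z = (\<lambda>g. \<Sum>k=2..n. b k * R (basis_vec (Y k)) g)"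
      unfolding R_def
      by (subst (2) z_def, unfold sum_smul, rule linear_on_gr_sum[OF cyc_op_linear[OF zV]]) (use YV in auto)
    then show ?thesis unfolding sum_smul by (auto simp: RY)
  qed
  have RYS: "R (smul (1 / 2) (basis_vec (Y (Suc i)))) = smul (1 / 2) (basis_vec (X (Suc i)))"
    if "i < n" for i
    using that cyc_op_smul[OF zV YV[of "Suc i"], folded R_def] by (simp add: RY)
  show ?thesis
    unfolding nu_def cyc_law_def z_def[symmetric] R_def[symmetric]
  proof (rule structure_constants_cong)
    fix i j assume "i \<in> gens n n" "j \<in> gens n n"
    then show "nu_table n b i j = (\<lambda>k. if j = Y 1 then R (basis_vec i) k
        else if j = X 1 then 2 * R (R (basis_vec i)) k else 0)"
      by (cases i; cases j)
         (auto simp: gens_def RX RY Rz RYS double_half smul_def[of 2] simp flip: z_def)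
  qed
qed

text \<open>The last basis vector is \<open>Y (n + 1)\<close>, so \<open>z\<close> is its product
  with \<open>Y 1\<close>. Here \<open>R (X k)\<close> is half of \<open>Y (k + 1)\<close>, and the
  factor 2 in \<open>2 R\<^sup>2\<close> cancels this half.\<close>

lemma eta_eq_cyc_law:
  fixes c :: "nat \<Rightarrow> 'a::field_char_0"
  assumes n: "1 \<le> n"
  shows "eta n c = cyc_law n (n + 1) (\<Sum>k=2..n. smul (c k) (basis_vec (X k)))"
proof -
  interpret interleaved n "n + 1" using n by unfold_locales auto
  define z :: "gen \<Rightarrow> 'a" where "z = (\<Sum>k=2..n. smul (c k) (basis_vec (X k)))"
  have YV: "(basis_vec (Y k) :: gen \<Rightarrow> 'a) \<in> V" if "k \<in> {1..n + 1}" for k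
    using that by (auto intro!: basis_vec_gr_space simp: gens_def)
  have XV: "(basis_vec (X k) :: gen \<Rightarrow> 'a) \<in> V" if "k \<in> {1..n}" for k
    using that by (auto intro!: basis_vec_gr_space simp: gens_def)
  define R where "R = cyc_op N z"
  have zV: "z \<in> V" unfolding z_def sum_smul using XV by (intro gr_space_sum) auto
  have RY: "R (basis_vec (Y i)) = (if i \<le> n then basis_vec (X i) else z)"
    if "i \<in> {1..n + 1}" for i
    using that unfolding R_def by (subst cyc_op_Y) (auto simp: gens_def)
  have RX: "R (basis_vec (X i)) = smul (1 / 2) (basis_vec (Y (Suc i)))"
    if "i \<in> {1..n}" for i
    using that unfolding R_def by (subst cyc_op_X) (auto simp: gens_def)
  have Rz: "R z = smul (1 / 2) (\<Sum>k=2..n. smul (c k) (basis_vec (Y (Suc k))))"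
  proof -
    have "R z = (\<lambda>g. \<Sum>k=2..n. c k * R (basis_vec (X k)) g)"
      unfolding R_def
      by (subst (2) z_def, unfold sum_smul, rule linear_on_gr_sum[OF cyc_op_linear[OF zV]]) (use XV in auto)
    then show ?thesis unfolding sum_smul by (auto simp: RX smul_def sum_distrib_left intro!: sum.cong)
  qed
  have RYS: "R (smul (1 / 2) (basis_vec (Y (Suc i)))) =
      smul (1 / 2) (if i < n then basis_vec (X (Suc i)) else z)"
    if "i \<le> n" for i
    using that cyc_op_smul[OF zV YV[of "Suc i"], folded R_def] by (simp add: RY)
  show ?thesis
    unfolding eta_def cyc_law_def z_def[symmetric] R_def[symmetric]
  proof (rule structure_constants_cong)
    fix i j assume "i \<in> gens n (n + 1)" "j \<in> gens n (n + 1)"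
    then show "eta_table n c i j = (\<lambda>k. if j = Y 1 then R (basis_vec i) k
        else if j = X 1 then 2 * R (R (basis_vec i)) k else 0)"
      by (cases i; cases j)
         (auto simp: gens_def RX RY Rz RYS double_half smul_def[of 2] simp flip: z_def)
  qed
qed

text \<open>With \<open>n + n\<close> basis vectors \<open>z\<close> is odd, and excluding
  \<open>Y 1\<close> leaves the span of \<open>Y 2, \<dots>, Y n\<close>; the parameters are the
  coordinates.\<close>

lemma cyc_params_even:
  "cyc_params n n = range (\<lambda>b. \<Sum>k=2..n. smul (b k) (basis_vec (Y k)) :: gen \<Rightarrow> 'a::field)"
proof (intro equalityI subsetI)
  fix z :: "gen \<Rightarrow> 'a" assume "z \<in> cyc_params n n"
  then have z: "z (X i) = 0" "i \<notin> {2..n} \<Longrightarrow> z (Y i) = 0" for i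
    unfolding cyc_params_def homog_def gr_space_def gens_def
    by (force, cases "i = 1") (auto simp: image_iff)
  have "z = (\<Sum>k=2..n. smul (z (Y k)) (basis_vec (Y k)))"
  proof
    fix g
    have "(\<Sum>k=2..n. z (Y k) * basis_vec (Y k) g) = (\<Sum>k=2..n. if g = Y k then z g else 0)"
      by (intro sum.cong) (auto simp: basis_vec_def)
    also have "\<dots> = z g"
      using z by (cases g) auto
    finally show "z g = (\<Sum>k=2..n. smul (z (Y k)) (basis_vec (Y k))) g"
      by (simp add: sum_smul)
  qed
  then show "z \<in> range (\<lambda>b. \<Sum>k=2..n. smul (b k) (basis_vec (Y k)))"
    by (rule range_eqI[of _ _ "\<lambda>k. z (Y k)"])
next
  fix z :: "gen \<Rightarrow> 'a" assume "z \<in> range (\<lambda>b. \<Sum>k=2..n. smul (b k) (basis_vec (Y k)))"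
  then obtain b where z: "z = (\<lambda>g. \<Sum>k=2..n. b k * basis_vec (Y k) g)"
    unfolding sum_smul by auto
  have "z \<in> homog n n 1"
    unfolding z by (intro homog_sum disjI2 basis_vec_homog) (auto simp: gens_def)
  moreover have "z (Y 1) = 0" "z (X 1) = 0"
    unfolding z basis_vec_def by (auto intro: sum.neutral)
  moreover have "Suc (n + n) mod 2 = 1" by presburger
  ultimately show "z \<in> cyc_params n n"
    unfolding cyc_params_def by simp
qed

text \<open>With \<open>n + (n + 1)\<close> basis vectors \<open>z\<close> is even, and excluding
  \<open>X 1\<close> leaves the span of \<open>X 2, \<dots>, X n\<close>.\<close>

lemma cyc_params_odd:
  "cyc_params n (n + 1) = range (\<lambda>c. \<Sum>k=2..n. smul (c k) (basis_vec (X k)) :: gen \<Rightarrow> 'a::field)"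
proof (intro equalityI subsetI)
  fix z :: "gen \<Rightarrow> 'a" assume "z \<in> cyc_params n (n + 1)"
  then have z: "z (Y i) = 0" "i \<notin> {2..n} \<Longrightarrow> z (X i) = 0" for i
    unfolding cyc_params_def homog_def gr_space_def gens_def
    by (force, cases "i = 1") (auto simp: image_iff)
  have "z = (\<Sum>k=2..n. smul (z (X k)) (basis_vec (X k)))"
  proof
    fix g
    have "(\<Sum>k=2..n. z (X k) * basis_vec (X k) g) = (\<Sum>k=2..n. if g = X k then z g else 0)"
      by (intro sum.cong) (auto simp: basis_vec_def)
    also have "\<dots> = z g"
      using z by (cases g) auto
    finally show "z g = (\<Sum>k=2..n. smul (z (X k)) (basis_vec (X k))) g"
      by (simp add: sum_smul)
  qed
  then show "z \<in> range (\<lambda>c. \<Sum>k=2..n. smul (c k) (basis_vec (X k)))"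
    by (rule range_eqI[of _ _ "\<lambda>k. z (X k)"])
next
  fix z :: "gen \<Rightarrow> 'a" assume "z \<in> range (\<lambda>c. \<Sum>k=2..n. smul (c k) (basis_vec (X k)))"
  then obtain c where z: "z = (\<lambda>g. \<Sum>k=2..n. c k * basis_vec (X k) g)"
    unfolding sum_smul by auto
  have "z \<in> homog n (n + 1) 0"
    unfolding z by (intro homog_sum disjI2 basis_vec_homog) (auto simp: gens_def)
  moreover have "z (Y 1) = 0" "z (X 1) = 0"
    unfolding z basis_vec_def by (auto intro: sum.neutral)
  ultimately show "z \<in> cyc_params n (n + 1)"
    unfolding cyc_params_def by simp
qed

theorem theorem4p13:
  fixes n :: nat
  assumes "n \<ge> 1"
  shows "irreducible_component
           (subtopology (zariski (coords n n)) (Leib n n))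
           (zariski (coords n n) closure_of
              (\<Union>b :: nat \<Rightarrow> 'a::field_char_0. Orb n n (nu n b)))
       \<and> irreducible_component
           (subtopology (zariski (coords n (n + 1))) (Leib n (n + 1)))
           (zariski (coords n (n + 1)) closure_of
              (\<Union>c :: nat \<Rightarrow> 'a. Orb n (n + 1) (eta n c)))"
proof -
  interpret even: interleaved n n using assms by unfold_locales auto
  interpret odd: interleaved n "n + 1" using assms by unfold_locales auto
  \<comment> \<open>The vectors \<open>z\<close> range over precisely the parameter vectors of the
    family, so the two unions of orbits coincide.\<close>
  have "even.cyc_orbits = (\<Union>b :: nat \<Rightarrow> 'a. Orb n n (nu n b))"
    unfolding even.cyc_orbits_def cyc_params_even nu_eq_cyc_law[OF assms] image_image ..
  moreover have "odd.cyc_orbits = (\<Union>c :: nat \<Rightarrow> 'a. Orb n (n + 1) (eta n c))"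
    unfolding odd.cyc_orbits_def cyc_params_odd eta_eq_cyc_law[OF assms] image_image ..
  ultimately show ?thesis
    using even.irreducible_component_cyc_orbits[where 'a = 'a]
      odd.irreducible_component_cyc_orbits[where 'a = 'a] by simp
qed

end
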